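(* Let $R_{sp}(\lambda)=R_{-1}\lambda^{-1}+R_{-2}\lambda^{-2}+R_{-3}\lambda^{-3}+\cdots\in\mathbb{C}(\lambda)^{m\times m}$ be a strictly proper rational matrix given by its Laurent expansion around infinity, and let $H,H_\sigma\in\mathbb{C}^{km\times km}$ be its associated block Hankel matrices defined in the context, with $k$ sufficiently large as specified there, and $r_f:=\operatorname{rank}H$. Let $S:=\operatorname{diag}(-I_m,(-1)^2I_m,\ldots,(-1)^kI_m)$. Let $U,V\in\mathbb{C}^{km\times km}$ be unitary matrices such that $$U^*HV=\begin{bmatrix}\widehat H&0\\0&0\end{bmatrix},\qquad \widehat H\in\mathbb{C}^{r_f\times r_f}\ \text{invertible},$$ where $U=V$ if $R_{sp}(\lambda)$ is Hermitian or skew-Hermitian, and $U=SV$ if $R_{sp}(\lambda)$ is para-Hermitian or para-skew-Hermitian. Let $U_1,V_1$ be the $km\times r_f$ matrices formed by the first $r_f$ columns of $U$ and $V$, respectively, so $\widehat H=U_1^*HV_1$, and let $V_{11}$ be the $m\times r_f$ matrix formed by the first $m$ rows of $V_1$. 1. If $R_{sp}(\lambda)$ is Hermitian, then $\widehat H^*=\widehat H$, $H_\sigma^*=H_\sigma$, and $$L_{sp}(\lambda):=\left[\begin{array}{c|c}V_1^*H_\sigma V_1-\lambda\widehat H&\widehat HV_{11}^*\\ \hline V_{11}\widehat H&0\end{array}\right]$$ is a Hermitian strongly minimal linearization of $R_{sp}(\lambda)$. 2. If $R_{sp}(\lambda)$ is skew-Hermitian, then $\widehat H^*=-\widehat H$,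 $H_\sigma^*=-H_\sigma$, and $$L_{sp}(\lambda):=\left[\begin{array}{c|c}V_1^*H_\sigma V_1-\lambda\widehat H&\widehat HV_{11}^*\\ \hline V_{11}\widehat H&0\end{array}\right]$$ is a skew-Hermitian strongly minimal linearization of $R_{sp}(\lambda)$. 3. If $R_{sp}(\lambda)$ is para-Hermitian, then $\widehat H^*=-\widehat H$, $(SH_\sigma)^*=SH_\sigma$, and $$L_{sp}(\lambda):=\left[\begin{array}{c|c}V_1^*SH_\sigma V_1-\lambda\widehat H&\widehat HV_{11}^*\\ \hline -V_{11}\widehat H&0\end{array}\right]$$ is a para-Hermitian strongly minimal linearization of $R_{sp}(\lambda)$. 4. If $R_{sp}(\lambda)$ is para-skew-Hermitian, then $\widehat H^*=\widehat H$, $(SH_\sigma)^*=-SH_\sigma$, and $$L_{sp}(\lambda):=\left[\begin{array}{c|c}V_1^*SH_\sigma V_1-\lambda\widehat H&\widehat HV_{11}^*\\ \hline -V_{11}\widehat H&0\end{array}\right]$$ is a para-skew-Hermitian strongly minimal linearization of $R_{sp}(\lambda)$.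
   Context: **Self-conjugate structures.** A square rational matrix (in particular a pencil) $M(\lambda)$ is: Hermitian if $[M(\lambda)]^*=M(\overline\lambda)$; skew-Hermitian if $[M(\lambda)]^*=-M(\overline\lambda)$; para-Hermitian if $[M(\lambda)]^*=M(-\overline\lambda)$; para-skew-Hermitian if $[M(\lambda)]^*=-M(-\overline\lambda)$. Here $^*$ is the conjugate transpose. **Block Hankel matrices.** A rational matrix is strictly proper if each entry has numerator degree less than denominator degree. For $R_{sp}(\lambda)=\sum_{i\ge1}R_{-i}\lambda^{-i}$, $H$ and $H_\sigma$ are the $k\times k$ block matrices whose $(i,j)$ blocks ($1\le i,j\le k$) are $R_{-(i+j-1)}$ and $R_{-(i+j)}$, respectively. It is assumed that $k$ is sufficiently large in the sense that $r_f=\operatorname{rank}H$ equals the total polar degree of the finite poles of $R_{sp}(\lambda)$, i.e. the sum of the degrees of the denominators in the Smith–McMillan form of $R_{sp}(\lambda)$ (this holds for all large enough $k$). **Strongly minimal linearization.** A square polynomial matrix is regular if its determinant is not identically zero. A linear polynomial system matrix is a block-partitioned pencil $$L(\lambda)=\begin{bmatrix}A(\lambda)&-B(\lambda)\\C(\lambda)&D(\lambda)\end{bmatrix}=\begin{bmatrix}\lambda A_1-A_0&-\lambda B_1+B_0\\ \lambda C_1-C_0&\lambda D_1-D_0\end{bmatrix}\in\mathbb{C}[\lambda]^{(p+m)\times(p+n)}$$ with $A(\lambda)\in\mathbb{C}[\lambda]^{p\times p}$ regular; its transfer function matrix is $D(\lambda)+C(\lambda)A(\lambda)^{-1}B(\lambda)$.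 It is strongly minimal if the pencils $[A(\lambda)\ \ -B(\lambda)]$ and $\begin{bmatrix}A(\lambda)\\C(\lambda)\end{bmatrix}$ have degree exactly 1 (when $p\ge1$) and no finite or infinite eigenvalues; that is, for every $\lambda_0\in\mathbb{C}$ the matrices $[A(\lambda_0)\ \ -B(\lambda_0)]$ and $\begin{bmatrix}A(\lambda_0)\\C(\lambda_0)\end{bmatrix}$ have rank $p$, and $[A_1\ \ -B_1]$ and $\begin{bmatrix}A_1\\C_1\end{bmatrix}$ have rank $p$. $L(\lambda)$ is a strongly minimal linearization of a rational matrix $R(\lambda)\in\mathbb{C}(\lambda)^{m\times n}$ if it is strongly minimal and its transfer function matrix is $R(\lambda)$. *)

theory Defs
  imports
    "HOL-Computational_Algebra.Computational_Algebra"
    "HOL-Computational_Algebra.Field_as_Ring"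
    "Jordan_Normal_Form.Schur_Decomposition"
    "Jordan_Normal_Form.Gauss_Jordan_Elimination"
    "Jordan_Normal_Form.DL_Rank"
begin

abbreviation mrank :: "complex mat \<Rightarrow> nat" where
  "mrank M \<equiv> vec_space.rank (dim_row M) M"

definition unitary_mat :: "complex mat \<Rightarrow> bool" where
  "unitary_mat U \<longleftrightarrow>
     square_mat U \<and> inverts_mat U (mat_adjoint U) \<and> inverts_mat (mat_adjoint U) U"

definition append_columns :: "'a :: zero mat \<Rightarrow> 'a mat \<Rightarrow> 'a mat" where
  "append_columns A B = four_block_mat A B (0\<^sub>m 0 (dim_col A)) (0\<^sub>m 0 (dim_col B))"

definition leading_submatrix :: "nat \<Rightarrow> nat \<Rightarrow> 'a mat \<Rightarrow> 'a mat" where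
  "leading_submatrix r c M = mat r c (\<lambda>(i, j). M $$ (i, j))"

definition const_pmat :: "complex mat \<Rightarrow> complex poly mat" where
  "const_pmat M = map_mat (\<lambda>c. [:c:]) M"

definition eval_pmat :: "complex poly mat \<Rightarrow> complex \<Rightarrow> complex mat" where
  "eval_pmat P z = map_mat (\<lambda>q. poly q z) P"

definition coeff_pmat :: "complex poly mat \<Rightarrow> nat \<Rightarrow> complex mat" where
  "coeff_pmat P i = map_mat (\<lambda>q. coeff q i) P"

text \<open>The zero matrix and matrices without entries get degree 0.\<close>

definition degree_pmat :: "complex poly mat \<Rightarrow> nat" where
  "degree_pmat P = Max (insert 0 (degree ` elements_mat P))"

definition rat_of_pmat :: "complex poly mat \<Rightarrow> complex poly fract mat" where
  "rat_of_pmat P = map_mat to_fract P"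

text \<open>\<^term>\<open>quot_of_fract r\<close> is the representation of \<^term>\<open>r\<close> in lowest terms
  with monic denominator, so that the poles of \<^term>\<open>r\<close> are the roots of \<open>denom r\<close>.\<close>

definition numer :: "complex poly fract \<Rightarrow> complex poly" where
  "numer r = fst (quot_of_fract r)"

definition denom :: "complex poly fract \<Rightarrow> complex poly" where
  "denom r = snd (quot_of_fract r)"

definition pole_at :: "complex poly fract mat \<Rightarrow> complex \<Rightarrow> bool" where
  "pole_at M z \<longleftrightarrow> (\<exists>r \<in> elements_mat M. poly (denom r) z = 0)"

definition eval_rmat :: "complex poly fract mat \<Rightarrow> complex \<Rightarrow> complex mat" where
  "eval_rmat M z = map_mat (\<lambda>r. poly (numer r) z / poly (denom r) z) M"

text \<open>The explicit case of the zero entry reflects the convention that the zero polynomial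
  has degree \<open>-\<infinity>\<close>, whereas the library assigns it degree 0.\<close>

definition strictly_proper :: "complex poly fract mat \<Rightarrow> bool" where
  "strictly_proper M \<longleftrightarrow>
     (\<forall>r \<in> elements_mat M. r = 0 \<or> degree (numer r) < degree (denom r))"

text \<open>The identities are required wherever both sides are defined.\<close>

definition hermitian_rmat :: "complex poly fract mat \<Rightarrow> bool" where
  "hermitian_rmat M \<longleftrightarrow> square_mat M \<and>
     (\<forall>z. \<not> pole_at M z \<longrightarrow> \<not> pole_at M (cnj z) \<longrightarrow>
        mat_adjoint (eval_rmat M z) = eval_rmat M (cnj z))"

definition skew_hermitian_rmat :: "complex poly fract mat \<Rightarrow> bool" where
  "skew_hermitian_rmat M \<longleftrightarrow> square_mat M \<and>
     (\<forall>z. \<not> pole_at M z \<longrightarrow> \<not> pole_at M (cnj z) \<longrightarrow>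
        mat_adjoint (eval_rmat M z) = - eval_rmat M (cnj z))"

definition para_hermitian_rmat :: "complex poly fract mat \<Rightarrow> bool" where
  "para_hermitian_rmat M \<longleftrightarrow> square_mat M \<and>
     (\<forall>z. \<not> pole_at M z \<longrightarrow> \<not> pole_at M (- cnj z) \<longrightarrow>
        mat_adjoint (eval_rmat M z) = eval_rmat M (- cnj z))"

definition para_skew_hermitian_rmat :: "complex poly fract mat \<Rightarrow> bool" where
  "para_skew_hermitian_rmat M \<longleftrightarrow> square_mat M \<and>
     (\<forall>z. \<not> pole_at M z \<longrightarrow> \<not> pole_at M (- cnj z) \<longrightarrow>
        mat_adjoint (eval_rmat M z) = - eval_rmat M (- cnj z))"

text \<open>The formal variable of the Laurent series is \<open>1/\<lambda>\<close>: a polynomial \<open>p(\<lambda>)\<close> is sent to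
  \<open>p(1/X)\<close>, and hence the coefficient of \<open>X ^ i\<close> is the one of \<open>\<lambda> ^ (- i)\<close>.\<close>

definition poly_at_inf :: "complex poly \<Rightarrow> complex fls" where
  "poly_at_inf p = poly (map_poly fls_const p) fls_X_inv"

definition laurent_at_inf :: "complex poly fract \<Rightarrow> complex fls" where
  "laurent_at_inf r = poly_at_inf (numer r) / poly_at_inf (denom r)"

text \<open>\<open>laurent_coeff R i\<close> is the coefficient \<open>R\<^bsub>-i\<^esub>\<close> of \<open>\<lambda> ^ (- i)\<close>.\<close>

definition laurent_coeff :: "complex poly fract mat \<Rightarrow> nat \<Rightarrow> complex mat" where
  "laurent_coeff R i = map_mat (\<lambda>r. fls_nth (laurent_at_inf r) (int i)) R"

text \<open>The entry in position \<open>(a, b)\<close> lies in the block with (0-based) block indices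
  \<open>(a div m, b div m)\<close>. In terms of 1-based block indices \<open>(i, j)\<close>, the block is
  \<open>R\<^bsub>-(i+j-1)\<^esub>\<close> for \<open>s = 1\<close> and \<open>R\<^bsub>-(i+j)\<^esub>\<close> for \<open>s = 2\<close>.\<close>

definition block_hankel :: "nat \<Rightarrow> nat \<Rightarrow> nat \<Rightarrow> complex poly fract mat \<Rightarrow> complex mat" where
  "block_hankel s m k R = mat (k * m) (k * m)
     (\<lambda>(a, b). laurent_coeff R (a div m + b div m + s) $$ (a mod m, b mod m))"

definition hankel :: "nat \<Rightarrow> nat \<Rightarrow> complex poly fract mat \<Rightarrow> complex mat" where
  "hankel = block_hankel 1"

definition hankel_shifted :: "nat \<Rightarrow> nat \<Rightarrow> complex poly fract mat \<Rightarrow> complex mat" where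
  "hankel_shifted = block_hankel 2"

definition sign_mat :: "nat \<Rightarrow> nat \<Rightarrow> complex mat" where
  "sign_mat m k = mat (k * m) (k * m)
     (\<lambda>(a, b). if a = b then (- 1) ^ (a div m + 1) else 0)"

definition unimodular_pmat :: "nat \<Rightarrow> complex poly mat \<Rightarrow> bool" where
  "unimodular_pmat n P \<longleftrightarrow> P \<in> carrier_mat n n \<and> is_unit (det P)"

text \<open>The lists \<open>es\<close> and \<open>ps\<close> hold the numerators and the denominators
  of the invariant rational functions.\<close>

definition smith_mcmillan_form ::
    "complex poly fract mat \<Rightarrow> complex poly list \<Rightarrow> complex poly list \<Rightarrow> bool" where
  "smith_mcmillan_form R es ps \<longleftrightarrow>
     length es = length ps \<and> length ps \<le> min (dim_row R) (dim_col R) \<and>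
     (\<forall>i < length ps. lead_coeff (es ! i) = 1 \<and> lead_coeff (ps ! i) = 1 \<and>
        coprime (es ! i) (ps ! i)) \<and>
     (\<forall>i. Suc i < length ps \<longrightarrow> es ! i dvd es ! Suc i \<and> ps ! Suc i dvd ps ! i) \<and>
     (\<exists>P Q. unimodular_pmat (dim_row R) P \<and> unimodular_pmat (dim_col R) Q \<and>
        rat_of_pmat P * R * rat_of_pmat Q = mat (dim_row R) (dim_col R)
          (\<lambda>(i, j). if i = j \<and> i < length ps then Fraction_Field.Fract (es ! i) (ps ! i) else 0))"

definition finite_polar_degree :: "complex poly fract mat \<Rightarrow> nat \<Rightarrow> bool" where
  "finite_polar_degree R d \<longleftrightarrow>
     (\<exists>es ps. smith_mcmillan_form R es ps \<and> d = sum_list (map degree ps))"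

definition regular_pmat :: "complex poly mat \<Rightarrow> bool" where
  "regular_pmat A \<longleftrightarrow> square_mat A \<and> det A \<noteq> 0"

definition system_matrix ::
    "complex poly mat \<Rightarrow> complex poly mat \<Rightarrow> complex poly mat \<Rightarrow> complex poly mat \<Rightarrow> complex poly mat"
  where "system_matrix A B C D = four_block_mat A (- B) C D"

definition linear_system ::
    "nat \<Rightarrow> nat \<Rightarrow> nat \<Rightarrow> complex poly mat \<Rightarrow> complex poly mat \<Rightarrow> complex poly mat \<Rightarrow> complex poly mat \<Rightarrow> bool"
  where "linear_system p m n A B C D \<longleftrightarrow>
     A \<in> carrier_mat p p \<and> B \<in> carrier_mat p n \<and> C \<in> carrier_mat m p \<and> D \<in> carrier_mat m n \<and>
     degree_pmat A \<le> 1 \<and> degree_pmat B \<le> 1 \<and> degree_pmat C \<le> 1 \<and> degree_pmat D \<le> 1 \<and>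
     regular_pmat A"

text \<open>For regular \<open>A\<close>, \<^const>\<open>mat_inverse\<close> returns \<^const>\<open>Some\<close> of the inverse of \<open>A\<close> over the
  field of rational functions.\<close>

definition transfer_function ::
    "complex poly mat \<Rightarrow> complex poly mat \<Rightarrow> complex poly mat \<Rightarrow> complex poly mat \<Rightarrow> complex poly fract mat"
  where "transfer_function A B C D =
     rat_of_pmat D + rat_of_pmat C * the (mat_inverse (rat_of_pmat A)) * rat_of_pmat B"

definition strongly_minimal ::
    "nat \<Rightarrow> complex poly mat \<Rightarrow> complex poly mat \<Rightarrow> complex poly mat \<Rightarrow> bool"
  where "strongly_minimal p A B C \<longleftrightarrow>
     (1 \<le> p \<longrightarrow> degree_pmat (append_columns A (- B)) = 1 \<and> degree_pmat (A @\<^sub>r C) = 1) \<and>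
     (\<forall>z. mrank (eval_pmat (append_columns A (- B)) z) = p \<and>
          mrank (eval_pmat (A @\<^sub>r C) z) = p) \<and>
     mrank (coeff_pmat (append_columns A (- B)) 1) = p \<and>
     mrank (coeff_pmat (A @\<^sub>r C) 1) = p"

text \<open>\<open>p\<close> is the size of the leading diagonal block and thus fixes the partition of \<open>L\<close>.\<close>

definition strongly_minimal_linearization ::
    "nat \<Rightarrow> complex poly mat \<Rightarrow> complex poly fract mat \<Rightarrow> bool"
  where "strongly_minimal_linearization p L R \<longleftrightarrow>
     (\<exists>A B C D. linear_system p (dim_row R) (dim_col R) A B C D \<and>
        L = system_matrix A B C D \<and> strongly_minimal p A B C \<and>
        transfer_function A B C D = R)"

end

theory Submission
  imports Defs
begin

text \<open>The Smith--McMillan form of \<open>R\<close> yields a factorization \<open>R\<^bsub>-(i+j+1)\<^esub> = C\<^sub>i B\<^sub>j\<close>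
  of all Laurent coefficients whose inner dimension is the finite polar degree \<open>r\<^sub>f\<close>. Invertibility
  of the compressed Hankel matrix makes the two block factors of \<open>H\<close> one-sided invertible,
  so that \<open>C\<^sub>i = C\<^sub>0 F\<^sup>i\<close> and \<open>B\<^sub>j = F\<^sup>j B\<^sub>0\<close> for a single matrix \<open>F\<close>. In suitable coordinates the
  pencil of the theorem is
  \<open>A(\<lambda>) = (F - \<lambda>) H'\<close>, \<open>-B(\<lambda>) = B\<^sub>0\<close>, \<open>C(\<lambda>) = C\<^sub>0 H'\<close>, where \<open>H'\<close> is the compressed Hankel matrix.
  Its transfer function \<open>C\<^sub>0 (\<lambda> - F)\<^sup>-\<^sup>1 B\<^sub>0\<close> has the Laurent coefficients of \<open>R\<close>, and the one-sided
  inverses give controllability and observability, that is, strong minimality. The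
  symmetry of the pencil comes from that of the Laurent coefficients.\<close>

section \<open>Laurent series at infinity\<close>

text \<open>That \<open>k\<close> is large enough enters as an equality of dimensions: the
  invertible compression \<open>Hhat\<close> has exactly the size \<open>d\<close> of the polar
  degree. The compressed factors \<open>X\<close> and \<open>Y\<close> of \<open>H\<close> are then
  square, so \<open>X * Y = Hhat\<close> makes both invertible, and the state space can be
  recoordinatized by \<open>X\<close>. Afterwards the block column of \<open>H\<close> is
  \<open>U1\<close> and its block row is \<open>Hhat\<close> times the adjoint of \<open>V1\<close>,
  which is why the blocks of the pencil can be written with \<open>V1\<close> and
  \<open>Hhat\<close>.

  Rational functions are compared as formal series in 1/\<lambda>, into which they embed as a field.
  There the inverse of \<lambda> - F applied to \<open>B 0\<close> is an explicit series, without
  any question of convergence.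

  The four structures are one condition with two signs: the adjoint of M(\<lambda>) is
  \<open>s\<close> times the value of M at \<open>e\<close> times the conjugate of \<lambda>. The
  matrix with diagonal blocks \<open>e ^ i\<close> is \<open>S\<close> for \<open>e = - 1\<close>
  and the identity for \<open>e = 1\<close>, so U = S V contains U = V. Passing from
  \<open>H\<close> to \<open>Hs\<close> costs one more factor \<open>e\<close>, hence the opposite
  signs of \<open>Hhat\<close> and \<open>S * Hs\<close> in the para cases.\<close>

lemma poly_at_inf_0 [simp]: "poly_at_inf 0 = 0"
  by (simp add: poly_at_inf_def)

lemma poly_at_inf_pCons: "poly_at_inf (pCons a p) = fls_const a + fls_X_inv * poly_at_inf p"
  by (simp add: poly_at_inf_def Polynomial.map_poly_pCons)

lemma poly_at_inf_nth:
  "fls_nth (poly_at_inf p) n = (if n \<le> 0 then coeff p (nat (- n)) else 0)"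
proof (induction p arbitrary: n)
  case 0
  then show ?case by simp
next
  case (pCons a p)
  have "nat (- n) = Suc (nat (- (n + 1)))" if "n < 0"
    using that by simp
  then show ?case
    by (auto simp: poly_at_inf_pCons fls_X_inv_times_conv_shift pCons.IH coeff_pCons split: nat.splits)
qed

lemma poly_at_inf_add: "poly_at_inf (p + q) = poly_at_inf p + poly_at_inf q"
  by (simp add: fls_eq_iff poly_at_inf_nth)

lemma poly_at_inf_smult: "poly_at_inf (Polynomial.smult c p) = fls_const c * poly_at_inf p"
  by (simp add: fls_eq_iff poly_at_inf_nth)

lemma poly_at_inf_1 [simp]: "poly_at_inf 1 = 1"
  by (auto simp: fls_eq_iff poly_at_inf_nth)

interpretation poly_at_inf: inj_comm_ring_hom poly_at_inf
proof
  show "poly_at_inf (x + y) = poly_at_inf x + poly_at_inf y" for x y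
    by (rule poly_at_inf_add)
  show "poly_at_inf (x * y) = poly_at_inf x * poly_at_inf y" for x y
    by (induction x) (simp_all add: poly_at_inf_pCons poly_at_inf_add poly_at_inf_smult algebra_simps)
  show "x = 0" if "poly_at_inf x = 0" for x
  proof (rule poly_eqI)
    fix n
    show "coeff x n = coeff 0 n"
      using arg_cong[OF that, of "\<lambda>f. fls_nth f (- int n)"] by (simp add: poly_at_inf_nth)
  qed
qed simp_all

lemma Fract_numer_denom: "Fraction_Field.Fract (numer r) (denom r) = r"
  by (simp add: numer_def denom_def)

lemma denom_nonzero [simp]: "denom r \<noteq> 0"
  by (simp add: denom_def)

text \<open>Frees \<open>laurent_at_inf\<close> from the representation in lowest terms: two
  representations differ by a cross multiplication of polynomials, which the embedding preserves.
  The homomorphism laws rest on this.\<close>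

lemma laurent_at_inf_Fract:
  assumes "b \<noteq> 0"
  shows "laurent_at_inf (Fraction_Field.Fract a b) = poly_at_inf a / poly_at_inf b"
proof -
  let ?r = "Fraction_Field.Fract a b"
  have "Fraction_Field.Fract (numer ?r) (denom ?r) = ?r"
    by (rule Fract_numer_denom)
  then have "numer ?r * b = a * denom ?r"
    using assms by (subst (asm) eq_fract) auto
  then have "poly_at_inf (numer ?r) * poly_at_inf b = poly_at_inf a * poly_at_inf (denom ?r)"
    by (metis poly_at_inf.hom_mult)
  with assms show ?thesis
    by (simp add: laurent_at_inf_def frac_eq_eq)
qed

interpretation laurent_at_inf: field_hom laurent_at_inf
proof
  fix x y :: "complex poly fract"
  obtain a b where x: "x = Fraction_Field.Fract a b" "b \<noteq> 0"
    by (cases x)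
  obtain c d where y: "y = Fraction_Field.Fract c d" "d \<noteq> 0"
    by (cases y)
  show "laurent_at_inf (x + y) = laurent_at_inf x + laurent_at_inf y"
    using x y by (simp add: laurent_at_inf_Fract hom_distribs add_frac_eq)
  show "laurent_at_inf (x * y) = laurent_at_inf x * laurent_at_inf y"
    using x y by (simp add: laurent_at_inf_Fract hom_distribs)
qed (simp_all add: Zero_fract_def One_fract_def laurent_at_inf_Fract)

lemma laurent_at_inf_to_fract: "laurent_at_inf (to_fract p) = poly_at_inf p"
  by (simp add: to_fract_def laurent_at_inf_Fract)

lemma poly_at_inf_const: "poly_at_inf [:c:] = fls_const c"
  by (simp add: poly_at_inf_pCons)

lemma poly_at_inf_monom: "poly_at_inf (monom c n) = fls_const c * fls_X_inv ^ n"
  by (simp add: poly_at_inf_def map_poly_monom poly_monom)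

lemma fls_subdegree_poly_at_inf: "fls_subdegree (poly_at_inf p) = - int (degree p)"
proof (cases "p = 0")
  case False
  then show ?thesis
    by (intro fls_subdegree_eqI) (auto simp: poly_at_inf_nth coeff_eq_0)
qed simp

text \<open>The subdegree of the quotient is the degree gap between denominator and numerator, and
  this gap is positive.\<close>

lemma laurent_strictly_proper_nth:
  assumes "r = 0 \<or> degree (numer r) < degree (denom r)" and "n \<le> 0"
  shows "fls_nth (laurent_at_inf r) n = 0"
proof (cases "r = 0")
  case False
  then have "numer r \<noteq> 0"
    by (simp add: numer_def)
  then have "fls_subdegree (laurent_at_inf r) = int (degree (denom r)) - int (degree (numer r))"
    unfolding laurent_at_inf_def
    by (subst fls_divide_subdegree) (auto simp: fls_subdegree_poly_at_inf)
  with assms False show ?thesis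
    by (intro fls_eq0_below_subdegree) auto
qed simp

section \<open>Conjugation and reflection of rational functions and their series\<close>

text \<open>If \<open>e\<close> is 1 or -1, this is the expansion at infinity of the function whose
  value at \<lambda> is the conjugate of f at \<open>e\<close> times the conjugate of
  \<lambda>.\<close>

definition fls_twist :: "complex \<Rightarrow> complex fls \<Rightarrow> complex fls" where
  "fls_twist e f = Abs_fls (\<lambda>n. e powi n * cnj (fls_nth f n))"

lemma fls_twist_nth [simp]: "fls_nth (fls_twist e f) n = e powi n * cnj (fls_nth f n)"
  unfolding fls_twist_def
  by (rule nth_Abs_fls_lower_bound[of "fls_subdegree f"]) auto

text \<open>The weights multiply in each term of the convolution. The convolution runs over a range
  given by the subdegrees, which the twist preserves for nonzero factors; zero factors are therefore
  split off.\<close>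

lemma fls_twist_mult:
  assumes "e \<noteq> 0"
  shows "fls_twist e (f * g) = fls_twist e f * fls_twist e g"
proof (cases "f = 0 \<or> g = 0")
  case True
  moreover have "fls_twist e 0 = 0"
    by (simp add: fls_eq_iff)
  ultimately show ?thesis
    by auto
next
  case False
  have sub: "fls_subdegree (fls_twist e h) = fls_subdegree h" if "h \<noteq> 0" for h
    using that assms by (intro fls_subdegree_eqI) auto
  have "fls_nth (fls_twist e (f * g)) n = fls_nth (fls_twist e f * fls_twist e g) n" for n
  proof -
    have eq: "e powi n * (x * y) = (e powi k * x) * (e powi (n - k) * y)" for k x y
      using power_int_add[of e k "n - k"] assms by (simp add: mult_ac)
    show ?thesis
      using False by (auto simp: fls_times_nth(2) sub sum_distrib_left intro!: sum.cong eq)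
  qed
  then show ?thesis
    by (simp add: fls_eq_iff)
qed

text \<open>The polynomial counterpart of \<open>fls_twist\<close>.\<close>

definition poly_twist :: "complex \<Rightarrow> complex poly \<Rightarrow> complex poly" where
  "poly_twist e p = pcompose (map_poly cnj p) [:0, e:]"

lemma coeff_poly_twist: "coeff (poly_twist e p) n = e ^ n * cnj (coeff p n)"
  by (simp add: poly_twist_def coeff_pcompose_linear coeff_map_poly)

lemma poly_poly_twist:
  assumes "e * e = 1"
  shows "poly (poly_twist e p) (e * cnj z) = cnj (poly p z)"
proof -
  have "poly [:0, e:] (e * cnj z) = cnj z"
    using assms by (simp add: mult.left_commute[of _ e] flip: mult.assoc)
  then show ?thesis
    by (simp only: poly_twist_def poly_pcompose) simp
qed

text \<open>The coefficient of \<lambda>^j sits at index -j and gets the weight \<open>e\<close> to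
  the power -j in the series but j in the polynomial; these agree because \<open>e\<close> is its
  own inverse.\<close>

lemma poly_at_inf_poly_twist:
  assumes "e * e = 1"
  shows "poly_at_inf (poly_twist e p) = fls_twist e (poly_at_inf p)"
proof -
  have "inverse e = e"
    using assms by (simp add: inverse_unique)
  then have "e powi n = e ^ nat (- n)" if "n \<le> 0" for n
    using that by (auto simp: power_int_def)
  then show ?thesis
    by (auto simp: fls_eq_iff poly_at_inf_nth coeff_poly_twist)
qed

text \<open>The symmetry notions are pointwise and say nothing at poles of any entry of the matrix.
  The finite set \<open>X\<close> absorbs such points; the cross-multiplied identity is then one
  between polynomials that holds at infinitely many points, so it holds identically and passes to
  the series.\<close>

lemma laurent_at_inf_twist:
  assumes e: "e * e = 1" and "finite X"
    and *: "\<And>z. z \<notin> X \<Longrightarrow> poly (denom r) z \<noteq> 0 \<Longrightarrow> poly (denom s) (e * cnj z) \<noteq> 0 \<Longrightarrow>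
      cnj (poly (numer r) z / poly (denom r) z) =
        d * (poly (numer s) (e * cnj z) / poly (denom s) (e * cnj z))"
  shows "fls_twist e (laurent_at_inf r) = fls_const d * laurent_at_inf s"
proof -
  from e have [simp]: "e \<noteq> 0"
    by auto
  let ?nr = "poly_twist e (numer r)" and ?dr = "poly_twist e (denom r)"
  define D where "D = ?nr * denom s - [:d:] * numer s * ?dr"
  have dr: "?dr \<noteq> 0"
    using denom_nonzero[of r] by (auto simp: poly_eq_iff coeff_poly_twist simp del: denom_nonzero)
  have inj: "inj (\<lambda>z. e * cnj z)"
    by (auto intro!: injI)
  \<comment> \<open>The zeros of the two denominators are excluded too, since division by zero would
    return 0 there.\<close>
  let ?Y = "X \<union> {z. poly (denom r) z = 0} \<union> (\<lambda>z. e * cnj z) -` {w. poly (denom s) w = 0}"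
  have "finite ?Y"
    using \<open>finite X\<close> inj by (intro finite_UnI finite_vimageI poly_roots_finite) simp_all
  then have "infinite ((\<lambda>z. e * cnj z) ` (- ?Y))"
    using inj infinite_UNIV_char_0[where 'a = complex]
    by (metis Compl_eq_Diff_UNIV finite_Diff2 finite_imageD inj_on_subset subset_UNIV)
  moreover have "(\<lambda>z. e * cnj z) ` (- ?Y) \<subseteq> {w. poly D w = 0}"
  proof (intro image_subsetI CollectI)
    fix z
    assume "z \<in> - ?Y"
    then have "cnj (poly (numer r) z) * poly (denom s) (e * cnj z) =
        d * poly (numer s) (e * cnj z) * cnj (poly (denom r) z)"
      using *[of z] by (simp add: field_simps)
    then show "poly D (e * cnj z) = 0"
      by (simp add: D_def poly_poly_twist[OF e])
  qed
  ultimately have "D = 0"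
    using poly_roots_finite finite_subset by blast
  then have "?nr * denom s = [:d:] * numer s * ?dr"
    by (simp add: D_def)
  then have "poly_at_inf (?nr * denom s) = poly_at_inf ([:d:] * numer s * ?dr)"
    by (rule arg_cong)
  then have "poly_at_inf ?nr / poly_at_inf ?dr = fls_const d * laurent_at_inf s"
    using dr unfolding poly_at_inf.hom_mult poly_at_inf_const
    by (simp add: laurent_at_inf_def frac_eq_eq)
  \<comment> \<open>Multiplicativity of the twist is applied to quotient times denominator, so no
    rule for twisting a quotient is needed.\<close>
  moreover have "fls_twist e (laurent_at_inf r) * poly_at_inf ?dr = poly_at_inf ?nr"
    by (simp add: poly_at_inf_poly_twist[OF e] laurent_at_inf_def flip: fls_twist_mult)
  then have "fls_twist e (laurent_at_inf r) = poly_at_inf ?nr / poly_at_inf ?dr"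
    using dr by (simp add: eq_divide_eq)
  ultimately show ?thesis
    by simp
qed

section \<open>Factoring the Hankel matrices\<close>

text \<open>Multiplication by \<lambda>^t shifts indices by t. The alternative \<open>r = 0\<close>
  admits \<open>D = 0\<close>, which occurs for remainders modulo a constant denominator.\<close>

lemma fls_nth_mult_poly_at_inf:
  assumes "degree r < D \<or> r = 0"
  shows "fls_nth (f * poly_at_inf r) n = (\<Sum>t<D. fls_nth f (n + int t) * coeff r t)"
proof -
  have "r = (\<Sum>t<D. monom (coeff r t) t)"
    using assms by (auto simp: poly_eq_iff coeff_sum coeff_monom coeff_eq_0 not_less)
  then have "poly_at_inf r = poly_at_inf (\<Sum>t<D. monom (coeff r t) t)"
    by (rule arg_cong)
  also have "\<dots> = (\<Sum>t<D. fls_const (coeff r t) * fls_X_inv ^ t)"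
    by (simp only: poly_at_inf.hom_sum poly_at_inf_monom)
  finally have "poly_at_inf r = (\<Sum>t<D. fls_const (coeff r t) * fls_X_inv ^ t)" .
  moreover have "fls_nth (f * (fls_const c * fls_X_inv ^ t)) n = fls_nth f (n + int t) * c" for c t
  proof -
    have "f * (fls_const c * fls_X_inv ^ t) = fls_const c * (fls_X_inv ^ t * f)"
      by (simp add: mult_ac)
    then show ?thesis
      by (simp add: fls_X_inv_power_times_conv_shift add.commute)
  qed
  ultimately show ?thesis
    by (simp add: sum_distrib_left fls_nth_sum)
qed

text \<open>The infinite block Hankel matrix factors through a space of dimension \<open>d\<close>,
  uniformly in every finite section. Scalar families with unbounded indices replace matrices, so
  that sums carry no side conditions on dimensions.\<close>

definition hankel_factors :: "nat \<Rightarrow> (nat \<Rightarrow> nat \<Rightarrow> nat \<Rightarrow> complex) \<Rightarrow> bool" where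
  "hankel_factors d h \<longleftrightarrow>
     (\<exists>P Q. \<forall>i a j b. h (i + j + 1) a b = (\<Sum>t<d. P i a t * Q j t b))"

lemma hankel_factors_0: "hankel_factors 0 (\<lambda>n a b. 0)"
  by (simp add: hankel_factors_def)

lemma sum_lessThan_add:
  fixes f :: "nat \<Rightarrow> 'a :: comm_monoid_add"
  shows "(\<Sum>t<m + n. f t) = (\<Sum>t<m. f t) + (\<Sum>t<n. f (m + t))"
  by (induction n) (simp_all add: add.assoc)

text \<open>The intermediate space of a sum is the direct sum of the two intermediate
  spaces.\<close>

lemma hankel_factors_add:
  assumes "hankel_factors d h" and "hankel_factors d' h'"
  shows "hankel_factors (d + d') (\<lambda>n a b. h n a b + h' n a b)"
proof -
  from assms(1) obtain P Q where "\<forall>i a j b. h (i + j + 1) a b = (\<Sum>t<d. P i a t * Q j t b)"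
    unfolding hankel_factors_def by (elim exE) (rule that)
  moreover from assms(2) obtain P' Q' where
    "\<forall>i a j b. h' (i + j + 1) a b = (\<Sum>t<d'. P' i a t * Q' j t b)"
    unfolding hankel_factors_def by (elim exE) (rule that)
  ultimately show ?thesis
    unfolding hankel_factors_def
    by (intro exI[of _ "\<lambda>i a t. if t < d then P i a t else P' i a (t - d)"]
        exI[of _ "\<lambda>j t b. if t < d then Q j t b else Q' j (t - d) b"])
      (simp add: sum_lessThan_add)
qed

text \<open>The Hankel operator of \<open>u e v / p\<close> factors through \<open>\<complex>[\<lambda>] / (p)\<close>, since multiplying \<open>u e / p\<close>
  by a multiple of \<open>p\<close> yields a polynomial, which has no coefficients at negative powers of \<open>\<lambda>\<close>.\<close>

lemma hankel_factors_single:
  assumes "p \<noteq> 0"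
  shows "hankel_factors (degree p)
    (\<lambda>n a b. fls_nth (poly_at_inf (u a) * (poly_at_inf e / poly_at_inf p) * poly_at_inf (v b)) (int n))"
proof -
  have "fls_nth (poly_at_inf (u a) * (poly_at_inf e / poly_at_inf p) * poly_at_inf (v b)) (int (i + j + 1)) =
      (\<Sum>t<degree p. fls_nth (poly_at_inf (u a) * (poly_at_inf e / poly_at_inf p)) (int (i + 1) + int t) *
        coeff (monom 1 j * v b mod p) t)" for a b i j
  proof -
    define f where "f = poly_at_inf (u a) * (poly_at_inf e / poly_at_inf p)"
    \<comment> \<open>Multiplying by \<lambda>^j moves index i+j+1 to i+1, so the dependence on j is
      confined to the right factor, which can then be reduced modulo p.\<close>
    define x where "x = monom 1 j * v b"
    have pf: "f * poly_at_inf p = poly_at_inf (u a * e)"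
      using assms by (simp add: f_def hom_distribs)
    have "f * poly_at_inf x = f * poly_at_inf (p * (x div p) + x mod p)"
      by simp
    also have "\<dots> = poly_at_inf (u a * e * (x div p)) + f * poly_at_inf (x mod p)"
      using pf by (simp only: hom_distribs distrib_left mult.assoc[symmetric])
    finally have x_mod: "fls_nth (f * poly_at_inf x) (int (i + 1)) =
        fls_nth (f * poly_at_inf (x mod p)) (int (i + 1))"
      by (simp add: poly_at_inf_nth)
    have "f * poly_at_inf x = fls_X_inv ^ j * (f * poly_at_inf (v b))"
      by (simp add: x_def hom_distribs poly_at_inf_monom mult_ac)
    then have "fls_nth (f * poly_at_inf (v b)) (int (i + j + 1)) = fls_nth (f * poly_at_inf x) (int (i + 1))"
      by (simp add: fls_X_inv_power_times_conv_shift add_ac)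
    also note x_mod
    also have "degree (x mod p) < degree p \<or> x mod p = 0"
      using assms degree_mod_less by blast
    then have "fls_nth (f * poly_at_inf (x mod p)) (int (i + 1)) =
        (\<Sum>t<degree p. fls_nth f (int (i + 1) + int t) * coeff (x mod p) t)"
      by (rule fls_nth_mult_poly_at_inf)
    finally show ?thesis
      by (simp only: f_def x_def)
  qed
  then show ?thesis
    unfolding hankel_factors_def
    by (intro allI exI[of _ "\<lambda>j t b. coeff (monom 1 j * v b mod p) t"]
        exI[of _ "\<lambda>i a t. fls_nth (poly_at_inf (u a) * (poly_at_inf e / poly_at_inf p)) (int (i + 1) + int t)"])
qed

lemma hankel_factors_sum:
  fixes N :: nat
  assumes "\<And>l. l < N \<Longrightarrow> p l \<noteq> 0"
  shows "hankel_factors (\<Sum>l<N. degree (p l)) (\<lambda>n a b. fls_nth (\<Sum>l<N.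
    poly_at_inf (u l a) * (poly_at_inf (e l) / poly_at_inf (p l)) * poly_at_inf (v l b)) (int n))"
  using assms
proof (induction N)
  case 0
  then show ?case by (simp add: hankel_factors_0)
next
  case (Suc N)
  have "hankel_factors (\<Sum>l<N. degree (p l)) (\<lambda>n a b. fls_nth (\<Sum>l<N.
      poly_at_inf (u l a) * (poly_at_inf (e l) / poly_at_inf (p l)) * poly_at_inf (v l b)) (int n))"
    by (rule Suc.IH) (simp add: Suc.prems)
  moreover have "hankel_factors (degree (p N)) (\<lambda>n a b.
      fls_nth (poly_at_inf (u N a) * (poly_at_inf (e N) / poly_at_inf (p N)) * poly_at_inf (v N b)) (int n))"
    by (intro hankel_factors_single) (simp add: Suc.prems)
  ultimately show ?case
    unfolding sum.lessThan_Suc fls_plus_nth by (rule hankel_factors_add)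
qed

section \<open>From the Smith--McMillan form to a factorization of the Laurent coefficients\<close>

interpretation to_fract_hom: inj_idom_hom "to_fract :: complex poly \<Rightarrow> complex poly fract"
  by standard simp_all

lemma rat_of_pmat_mult:
  assumes "P \<in> carrier_mat a b" and "Q \<in> carrier_mat b c"
  shows "rat_of_pmat (P * Q) = rat_of_pmat P * rat_of_pmat Q"
  unfolding rat_of_pmat_def by (rule to_fract_hom.mat_hom_mult[OF assms])

lemma rat_of_pmat_carrier [simp]: "rat_of_pmat P \<in> carrier_mat a b \<longleftrightarrow> P \<in> carrier_mat a b"
  by (simp add: rat_of_pmat_def)

text \<open>The adjugate is a polynomial matrix, and the determinant is a unit, so the inverse stays
  polynomial.\<close>

lemma unimodular_pmat_inverse:
  assumes "unimodular_pmat n P"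
  obtains P' where "P' \<in> carrier_mat n n" and "P * P' = 1\<^sub>m n" and "P' * P = 1\<^sub>m n"
proof -
  from assms have P: "P \<in> carrier_mat n n" and "is_unit (det P)"
    by (simp_all add: unimodular_pmat_def)
  then obtain c where "1 = det P * c"
    by (elim dvdE)
  then have c: "det P * c = 1"
    by simp
  note adj = adj_mat[OF P]
  show thesis
  proof (rule that)
    show "c \<cdot>\<^sub>m adj_mat P \<in> carrier_mat n n"
      using adj by simp
    have *: "c \<cdot>\<^sub>m (det P \<cdot>\<^sub>m 1\<^sub>m n) = 1\<^sub>m n"
      using c by (intro eq_matI) (auto simp: mult.commute)
    show "P * (c \<cdot>\<^sub>m adj_mat P) = 1\<^sub>m n"
      using mult_smult_distrib[OF P adj(1), of c] adj(2) * by simp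
    show "c \<cdot>\<^sub>m adj_mat P * P = 1\<^sub>m n"
      using mult_smult_assoc_mat[OF adj(1) P, of c] adj(3) * by simp
  qed
qed

lemma rat_of_pmat_one: "rat_of_pmat (1\<^sub>m n) = 1\<^sub>m n"
  unfolding rat_of_pmat_def by (rule to_fract_hom.mat_hom_one)

lemma index_mult_mat_sum:
  assumes "A \<in> carrier_mat nr n" "B \<in> carrier_mat n nc" "i < nr" "j < nc"
  shows "(A * B) $$ (i, j) = (\<Sum>k<n. A $$ (i, k) * B $$ (k, j))"
  using assms by (auto simp: scalar_prod_def lessThan_atLeast0 intro!: sum.cong)

lemma index_mult_diag_mult:
  fixes A B :: "'a :: comm_ring_1 mat"
  assumes A: "A \<in> carrier_mat n n" and B: "B \<in> carrier_mat n n" and "N \<le> n" and ab: "a < n" "b < n"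
  shows "(A * mat n n (\<lambda>(i, j). if i = j \<and> i < N then f i else 0) * B) $$ (a, b) =
    (\<Sum>l<N. A $$ (a, l) * f l * B $$ (l, b))" (is "(A * ?D * B) $$ _ = _")
proof -
  have AD: "(A * ?D) $$ (a, l) = (if l < N then A $$ (a, l) * f l else 0)" if "l < n" for l
  proof -
    have "(A * ?D) $$ (a, l) = (\<Sum>k<n. A $$ (a, k) * ?D $$ (k, l))"
      using A ab that by (intro index_mult_mat_sum) auto
    also have "\<dots> = (\<Sum>k<n. if k = l then (if l < N then A $$ (a, l) * f l else 0) else 0)"
      using that by (intro sum.cong) auto
    finally show ?thesis
      using that by simp
  qed
  have "(A * ?D * B) $$ (a, b) = (\<Sum>l<n. (A * ?D) $$ (a, l) * B $$ (l, b))"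
    using A B ab by (intro index_mult_mat_sum mult_carrier_mat[of _ n n]) auto
  also have "\<dots> = (\<Sum>l<n. (if l < N then A $$ (a, l) * f l else 0) * B $$ (l, b))"
    by (intro sum.cong refl) (simp only: AD lessThan_iff)
  also have "\<dots> = (\<Sum>l<N. A $$ (a, l) * f l * B $$ (l, b))"
    using \<open>N \<le> n\<close> by (intro sum.mono_neutral_cong_right) auto
  finally show ?thesis .
qed

lemma mat_sandwich:
  assumes "A \<in> carrier_mat n n" "B \<in> carrier_mat n n" "A' \<in> carrier_mat n n" "B' \<in> carrier_mat n n"
    and "R \<in> carrier_mat n n"
  shows "A' * ((A * R) * B) * B' = (A' * A) * R * (B * B')"
proof -
  note c = assms mult_carrier_mat[of _ n n _ n]
  have "A' * ((A * R) * B) * B' = A' * ((A * R) * B * B')"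
    using c by (intro assoc_mult_mat) auto
  also have "(A * R) * B * B' = (A * R) * (B * B')"
    using c by (intro assoc_mult_mat) auto
  also have "A' * ((A * R) * (B * B')) = A' * (A * R) * (B * B')"
    using c by (intro assoc_mult_mat[symmetric]) auto
  also have "A' * (A * R) = A' * A * R"
    using c by (intro assoc_mult_mat[symmetric]) auto
  finally show ?thesis .
qed

text \<open>Undoing the unimodular transformations writes R as a sum of terms of rank at most one.
  That \<open>u\<close> and \<open>v\<close> are polynomial matters: the denominator of each term is
  then only \<open>ps ! l\<close>, whose degree bounds the term in
  \<open>hankel_factors_single\<close>.\<close>

lemma smith_mcmillan_form_expansion:
  assumes R: "R \<in> carrier_mat m m" and smf: "smith_mcmillan_form R es ps"
  shows "\<exists>u v. \<forall>a<m. \<forall>b<m. R $$ (a, b) = (\<Sum>l<length ps.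
    to_fract (u l a) * Fraction_Field.Fract (es ! l) (ps ! l) * to_fract (v l b))"
proof -
  let ?D = "mat m m (\<lambda>(i, j). if i = j \<and> i < length ps then Fraction_Field.Fract (es ! i) (ps ! i) else 0)"
  from smf R obtain P Q where PQ: "unimodular_pmat m P" "unimodular_pmat m Q"
    and D: "rat_of_pmat P * R * rat_of_pmat Q = ?D" and len: "length ps \<le> m"
    unfolding smith_mcmillan_form_def by auto
  from PQ have [simp]: "P \<in> carrier_mat m m" "Q \<in> carrier_mat m m"
    by (simp_all add: unimodular_pmat_def)
  obtain P' where [simp]: "P' \<in> carrier_mat m m" and inv_P: "P' * P = 1\<^sub>m m"
    using PQ(1) by (rule unimodular_pmat_inverse)
  obtain Q' where [simp]: "Q' \<in> carrier_mat m m" and inv_Q: "Q * Q' = 1\<^sub>m m"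
    using PQ(2) by (rule unimodular_pmat_inverse)
  let ?P = "rat_of_pmat P" and ?Q = "rat_of_pmat Q"
  let ?P' = "rat_of_pmat P'" and ?Q' = "rat_of_pmat Q'"
  have one: "?P' * ?P = 1\<^sub>m m" "?Q * ?Q' = 1\<^sub>m m"
    using inv_P inv_Q rat_of_pmat_mult[of P' m m P m] rat_of_pmat_mult[of Q m m Q' m] by (simp_all add: rat_of_pmat_one)
  have c: "?P \<in> carrier_mat m m" "?Q \<in> carrier_mat m m" "?P' \<in> carrier_mat m m" "?Q' \<in> carrier_mat m m"
    by simp_all
  have "?P' * ?D * ?Q' = ?P' * ((?P * R) * ?Q) * ?Q'"
    by (simp only: D)
  also have "\<dots> = (?P' * ?P) * R * (?Q * ?Q')"
    using c R by (rule mat_sandwich)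
  also have "\<dots> = R"
    using R by (simp add: one)
  finally have R': "R = ?P' * ?D * ?Q'" ..
  have "R $$ (a, b) = (\<Sum>l<length ps.
      to_fract (P' $$ (a, l)) * Fraction_Field.Fract (es ! l) (ps ! l) * to_fract (Q' $$ (l, b)))"
    if ab: "a < m" "b < m" for a b
  proof -
    have "R $$ (a, b) = (\<Sum>l<length ps.
        ?P' $$ (a, l) * Fraction_Field.Fract (es ! l) (ps ! l) * ?Q' $$ (l, b))"
      using index_mult_diag_mult[OF c(3,4) len ab, of "\<lambda>l. Fraction_Field.Fract (es ! l) (ps ! l)"]
      by (simp only: R'[symmetric])
    also have "\<dots> = (\<Sum>l<length ps.
      to_fract (P' $$ (a, l)) * Fraction_Field.Fract (es ! l) (ps ! l) * to_fract (Q' $$ (l, b)))"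
      using len ab by (intro sum.cong refl) (simp add: rat_of_pmat_def carrier_matD[of _ m m])
    finally show ?thesis .
  qed
  then show ?thesis
    by (intro exI[of _ "\<lambda>l a. P' $$ (a, l)"] exI[of _ "\<lambda>l b. Q' $$ (l, b)"]) simp
qed

text \<open>Each diagonal entry contributes an intermediate space of dimension
  \<open>degree (ps ! l)\<close>, and these add up to \<open>d\<close>. The factors do not depend on
  the truncation \<open>k\<close>.\<close>

lemma finite_polar_degree_factors:
  assumes R: "R \<in> carrier_mat m m" and "finite_polar_degree R d"
  shows "\<exists>O' C. (\<forall>i. O' i \<in> carrier_mat m d) \<and> (\<forall>j. C j \<in> carrier_mat d m) \<and>
    (\<forall>i j. laurent_coeff R (i + j + 1) = O' i * C j)"
proof -
  from assms obtain es ps where smf: "smith_mcmillan_form R es ps" and d: "d = sum_list (map degree ps)"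
    unfolding finite_polar_degree_def by auto
  obtain u v where
    uv: "\<forall>a<m. \<forall>b<m. R $$ (a, b) = (\<Sum>l<length ps.
    to_fract (u l a) * Fraction_Field.Fract (es ! l) (ps ! l) * to_fract (v l b))"
    using smith_mcmillan_form_expansion[OF R smf] by (elim exE) (rule that)
  have nz: "ps ! l \<noteq> 0" if "l < length ps" for l
    using that smf unfolding smith_mcmillan_form_def by force
  have "d = (\<Sum>l<length ps. degree (ps ! l))"
    by (simp add: d sum_list_sum_nth lessThan_atLeast0)
  then have "hankel_factors d (\<lambda>n a b. fls_nth (\<Sum>l<length ps. poly_at_inf (u l a) *
      (poly_at_inf (es ! l) / poly_at_inf (ps ! l)) * poly_at_inf (v l b)) (int n))"
    using hankel_factors_sum[of "length ps" "\<lambda>l. ps ! l", OF nz] by simp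
  then obtain P Q where
    PQ: "\<forall>i a j b. fls_nth (\<Sum>l<length ps. poly_at_inf (u l a) *
      (poly_at_inf (es ! l) / poly_at_inf (ps ! l)) * poly_at_inf (v l b)) (int (i + j + 1)) =
      (\<Sum>t<d. P i a t * Q j t b)"
    unfolding hankel_factors_def by (elim exE) (rule that)
  have "fls_nth (laurent_at_inf (R $$ (a, b))) (int (i + j + 1)) = (\<Sum>t<d. P i a t * Q j t b)"
    if "a < m" "b < m" for a b i j
  proof -
    have "laurent_at_inf (R $$ (a, b)) = (\<Sum>l<length ps. poly_at_inf (u l a) *
        (poly_at_inf (es ! l) / poly_at_inf (ps ! l)) * poly_at_inf (v l b))"
      using nz that by (simp add: uv hom_distribs laurent_at_inf_to_fract laurent_at_inf_Fract)
    then show ?thesis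
      by (simp only: PQ)
  qed
  then have "laurent_coeff R (i + j + 1) = mat m d (\<lambda>(a, t). P i a t) * mat d m (\<lambda>(t, b). Q j t b)" for i j
    using R by (intro eq_matI) (auto simp: laurent_coeff_def scalar_prod_def lessThan_atLeast0)
  then show ?thesis
    by (intro exI[of _ "\<lambda>i. mat m d (\<lambda>(a, t). P i a t)"] exI[of _ "\<lambda>j. mat d m (\<lambda>(t, b). Q j t b)"]
        conjI allI) (rule mat_carrier | assumption)+
qed

section \<open>Realizations of Hankel matrices\<close>

text \<open>A right inverse makes the matrix surjective, so its columns span the whole
  space.\<close>

lemma rank_right_inverse:
  fixes M :: "complex mat"
  assumes M: "M \<in> carrier_mat n nc" and N: "N \<in> carrier_mat nc n" and MN: "M * N = 1\<^sub>m n"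
  shows "mrank M = n"
proof -
  interpret vec_space "TYPE(complex)" n .
  have "x \<in> col_space M" if x: "x \<in> carrier_vec n" for x
  proof -
    have "M *\<^sub>v (N *\<^sub>v x) = x"
      using M N x MN by (simp flip: assoc_mult_mat_vec)
    then show ?thesis
      using M N x unfolding col_space_eq[OF M] by auto
  qed
  moreover have "col_space M \<subseteq> carrier_vec n"
    unfolding col_space_eq[OF M] using M by auto
  ultimately have span: "span (set (cols M)) = carrier_vec n"
    unfolding col_space_def by auto
  have "vs (carrier_vec n) = V"
    by (simp add: module_vec_def)
  then have "rank M = vectorspace.dim class_ring V"
    unfolding rank_def span by (rule arg_cong)
  then show ?thesis
    using M dim_is_n by simp
qed

lemma rank_left_inverse:
  fixes M :: "complex mat"
  assumes M: "M \<in> carrier_mat n nc" and N: "N \<in> carrier_mat nc n" and NM: "N * M = 1\<^sub>m nc"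
  shows "mrank M = nc"
proof -
  interpret vec_space "TYPE(complex)" n .
  have inj: "v = N *\<^sub>v (M *\<^sub>v v)" if "v \<in> carrier_vec nc" for v
    using M N NM that by (simp flip: assoc_mult_mat_vec)
  \<comment> \<open>Linear independence concerns the set of columns, so repeated columns must be
    ruled out first; \<open>N\<close> sends the columns to distinct unit vectors.\<close>
  have distinct: "distinct (cols M)"
    unfolding distinct_conv_nth
  proof (intro allI impI)
    fix i j assume ij: "i < length (cols M)" "j < length (cols M)" "i \<noteq> j"
    have "col (N * M) i = N *\<^sub>v col M i" "col (N * M) j = N *\<^sub>v col M j"
      using M N ij by auto
    moreover have "col (N * M) i \<noteq> col (N * M) j"
      using ij M unfolding NM by (auto simp: vec_eq_iff)
    ultimately show "cols M ! i \<noteq> cols M ! j"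
      using ij M by auto
  qed
  moreover have "lin_indpt (set (cols M))"
  proof
    assume "lin_dep (set (cols M))"
    then obtain v where v: "v \<in> carrier_vec nc" "v \<noteq> 0\<^sub>v nc" "M *\<^sub>v v = 0\<^sub>v n"
      using lin_depE[OF M _ distinct] by blast
    then have "v = N *\<^sub>v 0\<^sub>v n"
      using inj[of v] by simp
    then show False
      using v N by (auto simp: vec_eq_iff)
  qed
  ultimately show ?thesis
    using lin_indpt_full_rank[OF M] M by simp
qed

lemma append_columns_carrier:
  assumes "A \<in> carrier_mat n a" "B \<in> carrier_mat n b"
  shows "append_columns A B \<in> carrier_mat n (a + b)"
  unfolding append_columns_def
  using four_block_carrier_mat[OF assms(1), of "0\<^sub>m 0 (dim_col B)" 0 b] assms by auto

lemma append_columns_mult_append_rows: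
  assumes A: "A \<in> carrier_mat n a" and B: "B \<in> carrier_mat n b"
    and C: "C \<in> carrier_mat a c" and D: "D \<in> carrier_mat b c"
  shows "append_columns A B * (C @\<^sub>r D) = A * C + B * D"
proof -
  have "append_columns A B * (C @\<^sub>r D) =
      four_block_mat A B (0\<^sub>m 0 a) (0\<^sub>m 0 b) * four_block_mat C (0\<^sub>m a 0) D (0\<^sub>m b 0)"
    using assms by (simp add: append_columns_def append_rows_def carrier_matD)
  also have "\<dots> = four_block_mat (A * C + B * D) (A * 0\<^sub>m a 0 + B * 0\<^sub>m b 0)
      (0\<^sub>m 0 a * C + 0\<^sub>m 0 b * D) (0\<^sub>m 0 a * 0\<^sub>m a 0 + 0\<^sub>m 0 b * 0\<^sub>m b 0)"
    by (rule mult_four_block_mat) (use assms in auto)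
  also have "\<dots> = A * C + B * D"
    using assms by (intro eq_matI) auto
  finally show ?thesis .
qed

text \<open>Strong minimality will be certified by Bezout identities of this kind: the sum is a
  block row times a block column, so one identity shows full rank of either side, here of the block
  row.\<close>

lemma rank_append_columns:
  fixes A :: "complex mat"
  assumes A: "A \<in> carrier_mat n a" and B: "B \<in> carrier_mat n b"
    and C: "C \<in> carrier_mat a n" and D: "D \<in> carrier_mat b n"
    and one: "A * C + B * D = 1\<^sub>m n"
  shows "mrank (append_columns A B) = n"
  using append_columns_carrier[OF A B] carrier_append_rows[OF C D]
  by (rule rank_right_inverse) (simp only: append_columns_mult_append_rows[OF A B C D] one)

lemma rank_append_rows:
  fixes C :: "complex mat"
  assumes A: "A \<in> carrier_mat n a" and B: "B \<in> carrier_mat n b"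
    and C: "C \<in> carrier_mat a n" and D: "D \<in> carrier_mat b n"
    and one: "A * C + B * D = 1\<^sub>m n"
  shows "mrank (C @\<^sub>r D) = n"
  using carrier_append_rows[OF C D] append_columns_carrier[OF A B]
  by (rule rank_left_inverse) (simp only: append_columns_mult_append_rows[OF A B C D] one)

section \<open>Block columns and block rows\<close>

definition block_col :: "nat \<Rightarrow> nat \<Rightarrow> nat \<Rightarrow> (nat \<Rightarrow> 'a mat) \<Rightarrow> 'a mat" where
  "block_col k m n X = mat (k * m) n (\<lambda>(a, t). X (a div m) $$ (a mod m, t))"

definition block_row :: "nat \<Rightarrow> nat \<Rightarrow> nat \<Rightarrow> (nat \<Rightarrow> 'a mat) \<Rightarrow> 'a mat" where
  "block_row k m n X = mat n (k * m) (\<lambda>(t, b). X (b div m) $$ (t, b mod m))"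

lemma block_carrier [simp]:
  "block_col k m n X \<in> carrier_mat (k * m) n" "block_row k m n X \<in> carrier_mat n (k * m)"
  by (simp_all add: block_col_def block_row_def)

lemma div_mod_bounds:
  fixes a k m :: nat
  assumes "a < k * m"
  shows "a div m < k" "a mod m < m"
  using assms less_mult_imp_div_less by (auto intro!: mod_less_divisor gr0I)

lemma block_col_mult:
  fixes Y :: "'a :: comm_ring_1 mat"
  assumes "\<And>i. X i \<in> carrier_mat m p" and "Y \<in> carrier_mat p n"
  shows "block_col k m p X * Y = block_col k m n (\<lambda>i. X i * Y)"
proof (rule eq_matI)
  fix a t assume "a < dim_row (block_col k m n (\<lambda>i. X i * Y))" "t < dim_col (block_col k m n (\<lambda>i. X i * Y))"
  then have at: "a < k * m" "t < n"
    by (simp_all add: block_col_def)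
  then have "(block_col k m p X * Y) $$ (a, t) = (\<Sum>s<p. block_col k m p X $$ (a, s) * Y $$ (s, t))"
    using assms by (intro index_mult_mat_sum) auto
  also have "\<dots> = (\<Sum>s<p. X (a div m) $$ (a mod m, s) * Y $$ (s, t))"
    using at by (simp add: block_col_def)
  also have "\<dots> = (X (a div m) * Y) $$ (a mod m, t)"
    using assms at div_mod_bounds(2)[OF at(1)] by (intro index_mult_mat_sum[symmetric]) auto
  finally show "(block_col k m p X * Y) $$ (a, t) = block_col k m n (\<lambda>i. X i * Y) $$ (a, t)"
    using at by (simp add: block_col_def)
qed (use assms in \<open>auto simp: block_col_def\<close>)

lemma mult_block_row:
  fixes Y :: "'a :: comm_ring_1 mat"
  assumes "\<And>j. X j \<in> carrier_mat p m" and "Y \<in> carrier_mat n p"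
  shows "Y * block_row k m p X = block_row k m n (\<lambda>j. Y * X j)"
proof (rule eq_matI)
  fix t b assume "t < dim_row (block_row k m n (\<lambda>j. Y * X j))" "b < dim_col (block_row k m n (\<lambda>j. Y * X j))"
  then have tb: "t < n" "b < k * m"
    by (simp_all add: block_row_def)
  then have "(Y * block_row k m p X) $$ (t, b) = (\<Sum>s<p. Y $$ (t, s) * block_row k m p X $$ (s, b))"
    using assms by (intro index_mult_mat_sum) auto
  also have "\<dots> = (\<Sum>s<p. Y $$ (t, s) * X (b div m) $$ (s, b mod m))"
    using tb by (simp add: block_row_def)
  also have "\<dots> = (Y * X (b div m)) $$ (t, b mod m)"
    using assms tb div_mod_bounds(2)[OF tb(2)] by (intro index_mult_mat_sum[symmetric]) auto
  finally show "(Y * block_row k m p X) $$ (t, b) = block_row k m n (\<lambda>j. Y * X j) $$ (t, b)"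
    using tb by (simp add: block_row_def)
qed (use assms in \<open>auto simp: block_row_def\<close>)

text \<open>The right-hand side has the shape of the unfolded \<open>block_hankel\<close>, so a
  factorization of the Laurent coefficients turns directly into one of \<open>H\<close> and
  \<open>Hs\<close>.\<close>

lemma block_col_mult_block_row:
  fixes X :: "nat \<Rightarrow> 'a :: comm_ring_1 mat"
  assumes "\<And>i. X i \<in> carrier_mat m p" and "\<And>j. Y j \<in> carrier_mat p m"
  shows "block_col k m p X * block_row k m p Y =
    mat (k * m) (k * m) (\<lambda>(a, b). (X (a div m) * Y (b div m)) $$ (a mod m, b mod m))"
proof -
  have "block_col k m p X * block_row k m p Y = block_col k m (k * m) (\<lambda>i. block_row k m m (\<lambda>j. X i * Y j))"
    by (simp add: block_col_mult[OF assms(1) block_carrier(2)] mult_block_row[OF assms(2) assms(1)])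
  then show ?thesis
    by (auto simp: block_col_def block_row_def div_mod_bounds intro!: eq_matI)
qed

lemma block_row_add:
  fixes X Y :: "nat \<Rightarrow> 'a :: comm_ring_1 mat"
  assumes "\<And>j. X j \<in> carrier_mat n m" and "\<And>j. Y j \<in> carrier_mat n m"
  shows "block_row k m n (\<lambda>j. X j + Y j) = block_row k m n X + block_row k m n Y"
  using assms div_mod_bounds(2)
  by (intro eq_matI) (auto simp: block_row_def carrier_matD[OF assms(1)] carrier_matD[OF assms(2)])

text \<open>The Ho--Kalman argument: a factorization of the infinite Hankel matrix whose finite sections
  are one-sided invertible comes from a realization.\<close>

lemma hankel_realization:
  fixes B C :: "nat \<Rightarrow> complex mat"
  assumes C: "\<And>i. C i \<in> carrier_mat m d" and B: "\<And>j. B j \<in> carrier_mat d m"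
    and hankel: "\<And>i j. C (Suc i) * B j = C i * B (Suc j)"
    and K: "K \<in> carrier_mat d (k * m)" "K * block_col k m d C = 1\<^sub>m d"
    and G: "G \<in> carrier_mat (k * m) d" "block_row k m d B * G = 1\<^sub>m d"
  obtains F where "F \<in> carrier_mat d d" and "\<And>i. C (Suc i) = C i * F" and "\<And>j. B (Suc j) = F * B j"
proof -
  let ?B = "block_row k m d B" and ?C = "block_col k m d C"
  let ?B' = "block_row k m d (\<lambda>j. B (Suc j))"
  \<comment> \<open>Since \<open>F\<close> is to map the block row to the shifted block row,
    multiplying that equation by the right inverse \<open>G\<close> leaves this choice.\<close>
  define F where "F = ?B' * G"
  have F: "F \<in> carrier_mat d d"
    unfolding F_def using block_carrier(2) G(1) by (rule mult_carrier_mat)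
  have CF: "C i * F = C (Suc i)" for i
  proof -
    have "C i * F = (C i * ?B') * G"
      unfolding F_def using C block_carrier(2) G(1) by (rule assoc_mult_mat[symmetric])
    also have "C i * ?B' = C (Suc i) * ?B"
      by (simp add: mult_block_row[OF B C] hankel)
    also have "(C (Suc i) * ?B) * G = C (Suc i) * (?B * G)"
      using C block_carrier(2) G(1) by (rule assoc_mult_mat)
    also have "\<dots> = C (Suc i)"
      using C[of "Suc i"] G(2) by simp
    finally show ?thesis .
  qed
  \<comment> \<open>Both sides agree after multiplication by every \<open>C i\<close>; stacking
    these equations and applying the left inverse \<open>K\<close> removes the factor.\<close>
  have FB: "F * B j = B (Suc j)" for j
  proof -
    have FBj: "F * B j \<in> carrier_mat d m"
      using F B by simp
    have "C i * (F * B j) = C i * B (Suc j)" for i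
      using assoc_mult_mat[OF C[of i] F B[of j]] by (simp add: CF hankel)
    then have "?C * (F * B j) = ?C * B (Suc j)"
      by (simp add: block_col_mult[OF C FBj] block_col_mult[OF C B])
    then have "K * ?C * (F * B j) = K * ?C * B (Suc j)"
      using assoc_mult_mat[OF K(1) block_carrier(1)[of k m d C] FBj]
        assoc_mult_mat[OF K(1) block_carrier(1)[of k m d C] B[of "Suc j"]] by simp
    then show ?thesis
      by (simp only: K(2) left_mult_one_mat[OF FBj] left_mult_one_mat[OF B])
  qed
  show thesis
    using F by (rule that) (simp_all add: CF FB)
qed

text \<open>One direction of the Hautus test. Modulo the image of \<open>F - z\<close>, the matrix
  \<open>F\<close> acts as \<open>z\<close>, so every \<open>B j\<close> is congruent to
  \<open>z ^ j\<close> times \<open>B 0\<close>. Hence the image of the whole block row lies in the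
  joint image of \<open>F - z\<close> and \<open>B 0\<close>, and \<open>G\<close> shows that this
  is everything.\<close>

lemma controllable_right_inverse:
  fixes F :: "complex mat"
  assumes F: "F \<in> carrier_mat d d" and B: "\<And>j. B j \<in> carrier_mat d m"
    and step: "\<And>j. B (Suc j) = F * B j"
    and G: "G \<in> carrier_mat (k * m) d" "block_row k m d B * G = 1\<^sub>m d"
  obtains P T where "P \<in> carrier_mat d d" and "T \<in> carrier_mat m d"
    and "(F - z \<cdot>\<^sub>m 1\<^sub>m d) * P + B 0 * T = 1\<^sub>m d"
proof -
  let ?M = "F - z \<cdot>\<^sub>m 1\<^sub>m d"
  have M: "?M \<in> carrier_mat d d"
    using F by (simp add: minus_carrier_mat)
  have "\<exists>P T. P \<in> carrier_mat d m \<and> T \<in> carrier_mat m m \<and> B j = ?M * P + B 0 * T" for j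
  proof (induction j)
    case 0
    show ?case
      using B[of 0] M by (intro exI[of _ "0\<^sub>m d m"] exI[of _ "1\<^sub>m m"]) simp
  next
    case (Suc j)
    then obtain P T where PT: "P \<in> carrier_mat d m" "T \<in> carrier_mat m m" "B j = ?M * P + B 0 * T"
      by blast
    have "B (Suc j) = ?M * B j + z \<cdot>\<^sub>m B j"
      using F B[of j] unfolding step
      by (subst minus_mult_distrib_mat[of _ d d _ _ m]) (auto intro!: eq_matI)
    also have "z \<cdot>\<^sub>m B j = ?M * (z \<cdot>\<^sub>m P) + B 0 * (z \<cdot>\<^sub>m T)"
      using M PT(1,2) B[of 0]
      by (subst PT(3)) (simp add: add_smult_distrib_left_mat[of _ d m] mult_smult_distrib[of _ d d _ m] mult_smult_distrib[of _ d m _ m])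
    also have "?M * B j + (?M * (z \<cdot>\<^sub>m P) + B 0 * (z \<cdot>\<^sub>m T)) = ?M * (B j + z \<cdot>\<^sub>m P) + B 0 * (z \<cdot>\<^sub>m T)"
      using M PT(1,2) B[of 0] B[of j]
      by (subst mult_add_distrib_mat[of _ d d _ m]) (auto simp: assoc_add_mat[of _ d m, symmetric])
    finally show ?case
      using PT(1,2) B[of j] by (intro exI[of _ "B j + z \<cdot>\<^sub>m P"] exI[of _ "z \<cdot>\<^sub>m T"]) simp
  qed
  then obtain P T where PT: "\<And>j. P j \<in> carrier_mat d m" "\<And>j. T j \<in> carrier_mat m m"
      "\<And>j. B j = ?M * P j + B 0 * T j"
    by metis
  have "block_row k m d B = block_row k m d (\<lambda>j. ?M * P j + B 0 * T j)"
    by (simp flip: PT(3))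
  also have "\<dots> = ?M * block_row k m d P + B 0 * block_row k m m T"
    using M B[of 0] PT(1,2)
    by (subst block_row_add) (auto simp: mult_block_row[OF PT(1) M] mult_block_row[OF PT(2) B])
  finally have "1\<^sub>m d = (?M * block_row k m d P + B 0 * block_row k m m T) * G"
    using G(2) by simp
  also have "\<dots> = ?M * block_row k m d P * G + B 0 * block_row k m m T * G"
    by (rule add_mult_distrib_mat[OF mult_carrier_mat[OF M block_carrier(2)]
        mult_carrier_mat[OF B block_carrier(2)] G(1)])
  also have "\<dots> = ?M * (block_row k m d P * G) + B 0 * (block_row k m m T * G)"
    using assoc_mult_mat[OF M block_carrier(2) G(1)] assoc_mult_mat[OF B block_carrier(2) G(1)] by simp
  finally show thesis
    using mult_carrier_mat[OF block_carrier(2) G(1)]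
    by (intro that[of "block_row k m d P * G" "block_row k m m T * G"]) auto
qed

text \<open>Dual to the previous lemma by transposition. The plain transpose is used rather than the
  adjoint, so that \<open>z\<close> is not conjugated.\<close>

lemma observable_left_inverse:
  fixes F :: "complex mat"
  assumes F: "F \<in> carrier_mat d d" and C: "\<And>i. C i \<in> carrier_mat m d"
    and step: "\<And>i. C (Suc i) = C i * F"
    and K: "K \<in> carrier_mat d (k * m)" "K * block_col k m d C = 1\<^sub>m d"
  obtains P T where "P \<in> carrier_mat d d" and "T \<in> carrier_mat d m"
    and "P * (F - z \<cdot>\<^sub>m 1\<^sub>m d) + T * C 0 = 1\<^sub>m d"
proof -
  have CT: "(C i)\<^sup>T \<in> carrier_mat d m" for i
    using C by simp
  have "(C (Suc i))\<^sup>T = F\<^sup>T * (C i)\<^sup>T" for i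
    using transpose_mult[OF C F] by (simp add: step)
  moreover have "block_row k m d (\<lambda>i. (C i)\<^sup>T) = (block_col k m d C)\<^sup>T"
    using carrier_matD[OF C] div_mod_bounds by (intro eq_matI) (auto simp: block_row_def block_col_def)
  then have "block_row k m d (\<lambda>i. (C i)\<^sup>T) * K\<^sup>T = 1\<^sub>m d"
    using K(2) by (simp flip: transpose_mult[OF K(1) block_carrier(1)])
  ultimately obtain P T where PT: "P \<in> carrier_mat d d" "T \<in> carrier_mat m d"
    "(F\<^sup>T - z \<cdot>\<^sub>m 1\<^sub>m d) * P + (C 0)\<^sup>T * T = 1\<^sub>m d"
    using controllable_right_inverse[of "F\<^sup>T" d "\<lambda>i. (C i)\<^sup>T" m "K\<^sup>T" k z] F CT K(1) by auto
  let ?M = "F - z \<cdot>\<^sub>m 1\<^sub>m d"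
  have M: "?M \<in> carrier_mat d d"
    using F by (simp add: minus_carrier_mat)
  have "F\<^sup>T - z \<cdot>\<^sub>m 1\<^sub>m d = ?M\<^sup>T"
    using F by (intro eq_matI) auto
  then have "1\<^sub>m d = (P\<^sup>T * ?M + T\<^sup>T * C 0)\<^sup>T"
    using M PT(1,2) C[of 0] transpose_mult[of "P\<^sup>T" d d ?M d] transpose_mult[of "T\<^sup>T" d m "C 0" d] PT(3)
    by (subst transpose_add[of _ d d]) auto
  then have "P\<^sup>T * ?M + T\<^sup>T * C 0 = 1\<^sub>m d"
    by (metis Matrix.transpose_transpose transpose_one)
  then show thesis
    using PT(1,2) by (intro that[of "P\<^sup>T" "T\<^sup>T"]) auto
qed

section \<open>Strongly minimal pencils\<close>

lemma finite_elements_mat: "finite (elements_mat P)"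
  unfolding elements_mat_def by (rule finite_set)

lemma degree_pmat_le:
  assumes "\<And>i j. i < dim_row P \<Longrightarrow> j < dim_col P \<Longrightarrow> degree (P $$ (i, j)) \<le> n"
  shows "degree_pmat P \<le> n"
  unfolding degree_pmat_def using assms finite_elements_mat[of P]
  by (intro Max.boundedI) (auto dest!: elements_matD)

lemma degree_le_degree_pmat:
  assumes "i < dim_row P" "j < dim_col P"
  shows "degree (P $$ (i, j)) \<le> degree_pmat P"
  unfolding degree_pmat_def using assms finite_elements_mat[of P] by (intro Max_ge) auto

lemma const_pmat_carrier [simp]: "const_pmat M \<in> carrier_mat a b \<longleftrightarrow> M \<in> carrier_mat a b"
  by (simp add: const_pmat_def)

lemma const_pmat_mult:
  assumes "A \<in> carrier_mat a b" "B \<in> carrier_mat b c"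
  shows "const_pmat (A * B) = const_pmat A * const_pmat B"
  unfolding const_pmat_def using assms by (rule map_poly_mult(1))

lemma append_columns_index:
  assumes "A \<in> carrier_mat n a" "B \<in> carrier_mat n b" "i < n" "j < a + b"
  shows "append_columns A B $$ (i, j) = (if j < a then A $$ (i, j) else B $$ (i, j - a))"
  using assms by (auto simp: append_columns_def)

lemma append_rows_index:
  assumes "A \<in> carrier_mat a n" "B \<in> carrier_mat b n" "i < a + b" "j < n"
  shows "(A @\<^sub>r B) $$ (i, j) = (if i < a then A $$ (i, j) else B $$ (i - a, j))"
  using assms by (auto simp: append_rows_def)

text \<open>\<open>K\<close> and \<open>G\<close> witness observability and controllability on
  \<open>k\<close> blocks. The invertible \<open>E\<close>, later \<open>Hhat\<close>, multiplies
  the state from the right; this is what lets the pencil be symmetric although \<open>F\<close>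
  itself need not be.\<close>

locale minimal_realization =
  fixes k m d :: nat
    and F :: "complex mat" and B C :: "nat \<Rightarrow> complex mat" and K G E E' :: "complex mat"
  assumes F: "F \<in> carrier_mat d d"
    and B: "\<And>j. B j \<in> carrier_mat d m"
    and C: "\<And>i. C i \<in> carrier_mat m d"
    and B_Suc: "\<And>j. B (Suc j) = F * B j"
    and C_Suc: "\<And>i. C (Suc i) = C i * F"
    and K: "K \<in> carrier_mat d (k * m)" "K * block_col k m d C = 1\<^sub>m d"
    and G: "G \<in> carrier_mat (k * m) d" "block_row k m d B * G = 1\<^sub>m d"
    and E: "E \<in> carrier_mat d d" "E' \<in> carrier_mat d d" "E * E' = 1\<^sub>m d" "E' * E = 1\<^sub>m d"
begin

definition "A\<^sub>p = const_pmat (F * E) - [:0, 1:] \<cdot>\<^sub>m const_pmat E"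
text \<open>The upper right block as it stands in the pencil; the system matrix has
  \<open>- B\<close> there, so \<open>- B\<^sub>p\<close> is passed to the predicates on
  systems.\<close>

definition "B\<^sub>p = const_pmat (B 0)"
definition "C\<^sub>p = const_pmat (C 0 * E)"

lemma pencil_carrier [simp]:
  "A\<^sub>p \<in> carrier_mat d d" "B\<^sub>p \<in> carrier_mat d m" "C\<^sub>p \<in> carrier_mat m d"
  using F B mult_carrier_mat[OF C E(1)] E(1) by (simp_all add: A\<^sub>p_def B\<^sub>p_def C\<^sub>p_def minus_carrier_mat)

lemma pencil_index:
  "i < d \<Longrightarrow> j < d \<Longrightarrow> A\<^sub>p $$ (i, j) = [:(F * E) $$ (i, j), - E $$ (i, j):]"
  "i < d \<Longrightarrow> j < m \<Longrightarrow> B\<^sub>p $$ (i, j) = [:B 0 $$ (i, j):]"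
  "i < m \<Longrightarrow> j < d \<Longrightarrow> C\<^sub>p $$ (i, j) = [:(C 0 * E) $$ (i, j):]"
  using carrier_matD[OF F] carrier_matD[OF B] carrier_matD[OF C] carrier_matD[OF E(1)]
  by (simp_all add: A\<^sub>p_def B\<^sub>p_def C\<^sub>p_def const_pmat_def del: index_mult_mat(1))

text \<open>Multiplication by the constant matrix \<open>- E'\<close> turns the pencil into
  \<lambda> - F, whose determinant is the monic characteristic polynomial.\<close>

lemma A\<^sub>p_regular: "det A\<^sub>p \<noteq> 0"
proof -
  have carr: "F * E \<in> carrier_mat d d" "- E' \<in> carrier_mat d d"
    using F E by auto
  have EE: "E * - E' = - 1\<^sub>m d"
    using E by (simp add: carrier_matD[of _ d d])
  have FEE: "F * E * - E' = - F"
    using assoc_mult_mat[OF F E(1) carr(2)] F EE by simp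
  have "A\<^sub>p * const_pmat (- E') = char_poly_matrix F"
  proof -
    have "A\<^sub>p * const_pmat (- E') =
        const_pmat (F * E) * const_pmat (- E') - [:0, 1:] \<cdot>\<^sub>m const_pmat E * const_pmat (- E')"
      unfolding A\<^sub>p_def using F E by (intro minus_mult_distrib_mat[of _ d d _ _ d]) auto
    also have "\<dots> = const_pmat (- F) - [:0, 1:] \<cdot>\<^sub>m const_pmat (- 1\<^sub>m d)"
      using F E carr EE FEE
      by (simp add: mult_smult_assoc_mat[of _ d d _ d] flip: const_pmat_mult[of _ d d _ d])
    also have "\<dots> = char_poly_matrix F"
      using F by (intro eq_matI) (auto simp: const_pmat_def char_poly_matrix_def)
    finally show ?thesis .
  qed
  then have "det A\<^sub>p * det (const_pmat (- E')) = char_poly F"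
    using det_mult[of A\<^sub>p d "const_pmat (- E')"] E by (simp add: char_poly_def)
  moreover have "char_poly F \<noteq> 0"
    using degree_monic_char_poly[OF F] by auto
  ultimately show ?thesis
    by auto
qed

lemma linear_system: "linear_system d m m A\<^sub>p (- B\<^sub>p) C\<^sub>p (0\<^sub>m m m)"
proof -
  have "degree_pmat A\<^sub>p \<le> 1" "degree_pmat (- B\<^sub>p) \<le> 1" "degree_pmat C\<^sub>p \<le> 1"
    "degree_pmat (0\<^sub>m m m) \<le> 1"
    by (auto intro!: degree_pmat_le simp: pencil_index carrier_matD[OF pencil_carrier(1)]
        carrier_matD[OF pencil_carrier(2)] carrier_matD[OF pencil_carrier(3)])
  then show ?thesis
    using A\<^sub>p_regular carrier_matD[OF pencil_carrier(1)]
    by (simp add: linear_system_def regular_pmat_def)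
qed

lemma append_columns_pencil: "append_columns A\<^sub>p B\<^sub>p \<in> carrier_mat d (d + m)"
  by (intro append_columns_carrier) auto

lemma append_rows_pencil: "A\<^sub>p @\<^sub>r C\<^sub>p \<in> carrier_mat (d + m) d"
  by (intro carrier_append_rows) auto

lemmas append_columns_pencil_index = append_columns_index[OF pencil_carrier(1,2)]
lemmas append_rows_pencil_index = append_rows_index[OF pencil_carrier(1,3)]

lemma degree_append:
  assumes "1 \<le> d"
  shows "degree_pmat (append_columns A\<^sub>p B\<^sub>p) = 1" "degree_pmat (A\<^sub>p @\<^sub>r C\<^sub>p) = 1"
proof -
  note dims = carrier_matD[OF append_columns_pencil] carrier_matD[OF append_rows_pencil]
  \<comment> \<open>An invertible matrix of positive size has a nonzero entry, which yields an entry
    of degree exactly 1.\<close>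
  obtain i j where ij: "i < d" "j < d" "E $$ (i, j) \<noteq> 0"
  proof (rule ccontr)
    assume "\<not> thesis"
    then have "E = 0\<^sub>m d d"
      using that E(1) by (intro eq_matI) auto
    then have "1\<^sub>m d = (0\<^sub>m d d :: complex mat)"
      using E(2,3) by simp
    from arg_cong[OF this, of "\<lambda>M. M $$ (0, 0)"] show False
      using assms by simp
  qed
  then have deg: "degree (A\<^sub>p $$ (i, j)) = 1"
    by (simp add: pencil_index)
  show "degree_pmat (append_columns A\<^sub>p B\<^sub>p) = 1"
  proof (rule antisym)
    show "degree_pmat (append_columns A\<^sub>p B\<^sub>p) \<le> 1"
      by (intro degree_pmat_le) (auto simp: dims append_columns_pencil_index pencil_index)
    show "1 \<le> degree_pmat (append_columns A\<^sub>p B\<^sub>p)"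
      using degree_le_degree_pmat[of i "append_columns A\<^sub>p B\<^sub>p" j] ij deg
      by (simp add: dims append_columns_pencil_index)
  qed
  show "degree_pmat (A\<^sub>p @\<^sub>r C\<^sub>p) = 1"
  proof (rule antisym)
    show "degree_pmat (A\<^sub>p @\<^sub>r C\<^sub>p) \<le> 1"
      by (intro degree_pmat_le) (auto simp: dims append_rows_pencil_index pencil_index)
    show "1 \<le> degree_pmat (A\<^sub>p @\<^sub>r C\<^sub>p)"
      using degree_le_degree_pmat[of i "A\<^sub>p @\<^sub>r C\<^sub>p" j] ij deg
      by (simp add: dims append_rows_pencil_index)
  qed
qed

lemma eval_append:
  "eval_pmat (append_columns A\<^sub>p B\<^sub>p) z = append_columns ((F - z \<cdot>\<^sub>m 1\<^sub>m d) * E) (B 0)"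
  "eval_pmat (A\<^sub>p @\<^sub>r C\<^sub>p) z = (F - z \<cdot>\<^sub>m 1\<^sub>m d) * E @\<^sub>r C 0 * E"
proof -
  have M: "(F - z \<cdot>\<^sub>m 1\<^sub>m d) * E \<in> carrier_mat d d" "C 0 * E \<in> carrier_mat m d"
    using F E(1) mult_carrier_mat[OF C E(1)] by (auto simp: minus_carrier_mat)
  have "(F - z \<cdot>\<^sub>m 1\<^sub>m d) * E = F * E - z \<cdot>\<^sub>m E"
    using F E by (subst minus_mult_distrib_mat[of _ d d _ _ d]) auto
  then have ev: "((F - z \<cdot>\<^sub>m 1\<^sub>m d) * E) $$ (i, j) = (F * E) $$ (i, j) - z * E $$ (i, j)" if "i < d" "j < d" for i j
    using that carrier_matD[OF F] carrier_matD[OF E(1)] by simp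
  note dims = carrier_matD[OF append_columns_pencil] carrier_matD[OF append_rows_pencil]
    carrier_matD[OF append_columns_carrier[OF M(1) B[of 0]]]
    carrier_matD[OF carrier_append_rows[OF M]] carrier_matD[OF F] carrier_matD[OF E(1)]
    carrier_matD[OF B] carrier_matD[OF C]
  show "eval_pmat (append_columns A\<^sub>p B\<^sub>p) z = append_columns ((F - z \<cdot>\<^sub>m 1\<^sub>m d) * E) (B 0)"
    by (rule eq_matI)
      (auto simp: eval_pmat_def dims append_columns_pencil_index ev pencil_index
        append_columns_index[OF M(1) B] simp del: index_mult_mat(1))
  show "eval_pmat (A\<^sub>p @\<^sub>r C\<^sub>p) z = (F - z \<cdot>\<^sub>m 1\<^sub>m d) * E @\<^sub>r C 0 * E"
    by (rule eq_matI)
      (auto simp: eval_pmat_def dims append_rows_pencil_index ev pencil_index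
        append_rows_index[OF M] simp del: index_mult_mat(1))
qed

lemma coeff_append:
  "coeff_pmat (append_columns A\<^sub>p B\<^sub>p) 1 = append_columns (- E) (0\<^sub>m d m)"
  "coeff_pmat (A\<^sub>p @\<^sub>r C\<^sub>p) 1 = - E @\<^sub>r 0\<^sub>m m d"
proof -
  have M: "- E \<in> carrier_mat d d"
    using E by simp
  note dims = carrier_matD[OF append_columns_pencil] carrier_matD[OF append_rows_pencil]
    carrier_matD[OF append_columns_carrier[OF M zero_carrier_mat]]
    carrier_matD[OF carrier_append_rows[OF M zero_carrier_mat]] carrier_matD[OF E(1)]
  show "coeff_pmat (append_columns A\<^sub>p B\<^sub>p) 1 = append_columns (- E) (0\<^sub>m d m)"
    by (rule eq_matI)
      (auto simp: coeff_pmat_def dims append_columns_pencil_index pencil_index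
        append_columns_index[OF M zero_carrier_mat])
  show "coeff_pmat (A\<^sub>p @\<^sub>r C\<^sub>p) 1 = - E @\<^sub>r 0\<^sub>m m d"
    by (rule eq_matI)
      (auto simp: coeff_pmat_def dims append_rows_pencil_index pencil_index
        append_rows_index[OF M zero_carrier_mat])
qed

text \<open>At finite points the Hautus identities apply once \<open>E\<close> is absorbed: by
  \<open>E' * P\<close> for the block row, and by conjugation with \<open>E\<close> for the block
  column. At infinity the coefficient contains \<open>- E\<close>, which is invertible by
  itself.\<close>

lemma strongly_minimal: "strongly_minimal d A\<^sub>p (- B\<^sub>p) C\<^sub>p"
proof -
  have "mrank (eval_pmat (append_columns A\<^sub>p B\<^sub>p) z) = d" for z
  proof -
    let ?M = "F - z \<cdot>\<^sub>m 1\<^sub>m d"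
    have M: "?M \<in> carrier_mat d d"
      using F by (simp add: minus_carrier_mat)
    obtain P T where PT: "P \<in> carrier_mat d d" "T \<in> carrier_mat m d" "?M * P + B 0 * T = 1\<^sub>m d"
      using F B B_Suc G by (rule controllable_right_inverse)
    have "E * (E' * P) = P"
      using assoc_mult_mat[OF E(1,2) PT(1)] E(3) PT(1) by simp
    then have "?M * E * (E' * P) + B 0 * T = 1\<^sub>m d"
      using PT assoc_mult_mat[OF M E(1) mult_carrier_mat[OF E(2) PT(1)]] by simp
    then show ?thesis
      unfolding eval_append
      by (rule rank_append_columns[OF mult_carrier_mat[OF M E(1)] B mult_carrier_mat[OF E(2) PT(1)] PT(2)])
  qed
  moreover have "mrank (eval_pmat (A\<^sub>p @\<^sub>r C\<^sub>p) z) = d" for z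
  proof -
    let ?M = "F - z \<cdot>\<^sub>m 1\<^sub>m d"
    have M: "?M \<in> carrier_mat d d"
      using F by (simp add: minus_carrier_mat)
    obtain P T where PT: "P \<in> carrier_mat d d" "T \<in> carrier_mat d m" "P * ?M + T * C 0 = 1\<^sub>m d"
      using F C C_Suc K by (rule observable_left_inverse)
    note c = mult_carrier_mat[OF E(2) PT(1)] mult_carrier_mat[OF E(2) PT(2)]
      mult_carrier_mat[OF PT(1) M] mult_carrier_mat[OF PT(2) C]
    have "E' * P * (?M * E) + E' * T * (C 0 * E) = E' * (P * ?M + T * C 0) * E"
      using assoc_mult_mat[OF c(1) M E(1)] assoc_mult_mat[OF c(2) C E(1)]
        assoc_mult_mat[OF E(2) PT(1) M] assoc_mult_mat[OF E(2) PT(2) C]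
        mult_add_distrib_mat[OF E(2) c(3,4)]
        add_mult_distrib_mat[OF mult_carrier_mat[OF E(2) c(3)] mult_carrier_mat[OF E(2) c(4)] E(1)]
      by simp
    also have "\<dots> = 1\<^sub>m d"
      using E by (simp add: PT(3))
    finally show ?thesis
      unfolding eval_append
      by (rule rank_append_rows[OF c(1,2) mult_carrier_mat[OF M E(1)] mult_carrier_mat[OF C E(1)]])
  qed
  moreover have "mrank (coeff_pmat (append_columns A\<^sub>p B\<^sub>p) 1) = d"
    "mrank (coeff_pmat (A\<^sub>p @\<^sub>r C\<^sub>p) 1) = d"
    unfolding coeff_append using E
    by (intro rank_append_columns[of _ _ d _ m "- E'" "0\<^sub>m m d"] rank_append_rows[of "- E'" _ d "0\<^sub>m d m" m]; simp)+
  ultimately show ?thesis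
    unfolding strongly_minimal_def by (simp add: degree_append)
qed

end

section \<open>The transfer function\<close>

interpretation fls_const_hom: comm_ring_hom "fls_const :: complex \<Rightarrow> complex fls"
  by standard (simp_all add: fls_plus_const)

lemma mat_inverse_invertible:
  fixes A :: "'a :: field mat"
  assumes A: "A \<in> carrier_mat n n" and "det A \<noteq> 0"
  shows "the (mat_inverse A) \<in> carrier_mat n n" "the (mat_inverse A) * A = 1\<^sub>m n"
proof -
  have "A \<in> Units (ring_mat TYPE('a) n ())"
    using assms by (rule det_non_zero_imp_unit)
  then obtain A' where "mat_inverse A = Some A'"
    using mat_inverse(1)[OF A, where b = "()"] by (cases "mat_inverse A") auto
  then show "the (mat_inverse A) \<in> carrier_mat n n" "the (mat_inverse A) * A = 1\<^sub>m n"
    using mat_inverse(2)[OF A] by auto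
qed

lemma map_mat_laurent_rat_of_pmat:
  "map_mat laurent_at_inf (rat_of_pmat P) = map_mat poly_at_inf P"
  by (intro eq_matI) (simp_all add: rat_of_pmat_def laurent_at_inf_to_fract)

context minimal_realization
begin

text \<open>The expansion of \<open>(\<lambda> - F)\<^sup>-\<^sup>1 B 0\<close> at infinity.\<close>

definition resolvent :: "complex fls mat" where
  "resolvent = mat d m (\<lambda>(t, b). fls_X * fps_to_fls (Abs_fps (\<lambda>n. B n $$ (t, b))))"

lemma resolvent_carrier [simp]: "resolvent \<in> carrier_mat d m"
  by (simp add: resolvent_def)

lemma resolvent_nth:
  assumes "t < d" "b < m"
  shows "fls_nth (resolvent $$ (t, b)) n = (if n \<ge> 1 then B (nat (n - 1)) $$ (t, b) else 0)"
  using assms by (simp add: resolvent_def fls_X_times_conv_shift)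

lemma const_mult_resolvent_nth:
  assumes "M \<in> carrier_mat r d" "i < r" "b < m"
  shows "fls_nth ((map_mat fls_const M * resolvent) $$ (i, b)) n =
    (if n \<ge> 1 then (M * B (nat (n - 1))) $$ (i, b) else 0)"
proof -
  have "(map_mat fls_const M * resolvent) $$ (i, b) =
      (\<Sum>t<d. fls_const (M $$ (i, t)) * resolvent $$ (t, b))"
    using assms by (subst index_mult_mat_sum[of _ r d _ m]) (auto intro!: sum.cong)
  moreover have "(M * B j) $$ (i, b) = (\<Sum>t<d. M $$ (i, t) * B j $$ (t, b))" for j
    using assms B by (intro index_mult_mat_sum)
  ultimately show ?thesis
    using assms by (simp add: fls_nth_sum resolvent_nth)
qed

definition shifted :: "complex fls mat" where
  "shifted = map_mat fls_const F - fls_X_inv \<cdot>\<^sub>m 1\<^sub>m d"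

lemma shifted_carrier [simp]: "shifted \<in> carrier_mat d d"
  using F by (simp add: shifted_def minus_carrier_mat)

lemma shifted_mult:
  assumes W: "W \<in> carrier_mat d r"
  shows "shifted * W = map_mat fls_const F * W - fls_X_inv \<cdot>\<^sub>m W"
proof -
  have "shifted * W = map_mat fls_const F * W - fls_X_inv \<cdot>\<^sub>m 1\<^sub>m d * W"
    unfolding shifted_def using F W by (intro minus_mult_distrib_mat[of _ d d _ _ r]) auto
  also have "fls_X_inv \<cdot>\<^sub>m 1\<^sub>m d * W = fls_X_inv \<cdot>\<^sub>m W"
    using W mult_smult_assoc_mat[OF one_carrier_mat W, of fls_X_inv] by simp
  finally show ?thesis .
qed

text \<open>A telescoping product: \<open>fls_X_inv\<close> is \<lambda>, and F times the term of
  index n cancels \<lambda> times the term of index n+1. Only \<lambda> times the first term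
  survives, at index 0.\<close>

lemma shifted_mult_resolvent: "shifted * resolvent = map_mat poly_at_inf (- B\<^sub>p)"
proof (rule eq_matI)
  fix i b assume "i < dim_row (map_mat poly_at_inf (- B\<^sub>p))" "b < dim_col (map_mat poly_at_inf (- B\<^sub>p))"
  then have ib: "i < d" "b < m"
    by (simp_all add: carrier_matD[OF pencil_carrier(2)])
  have "fls_nth ((shifted * resolvent) $$ (i, b)) n = fls_nth (map_mat poly_at_inf (- B\<^sub>p) $$ (i, b)) n" for n
  proof -
    have "(shifted * resolvent) $$ (i, b) =
        (map_mat fls_const F * resolvent) $$ (i, b) - fls_X_inv * resolvent $$ (i, b)"
      unfolding shifted_mult[OF resolvent_carrier]
      using ib carrier_matD[OF resolvent_carrier] carrier_matD[OF F] by simp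
    then have "fls_nth ((shifted * resolvent) $$ (i, b)) n =
        (if n \<ge> 1 then B (Suc (nat (n - 1))) $$ (i, b) else 0) -
        (if n \<ge> 0 then B (nat n) $$ (i, b) else 0)"
      using ib by (simp add: const_mult_resolvent_nth[OF F] fls_X_inv_times_conv_shift resolvent_nth B_Suc del: index_mult_mat(1))
    also have "\<dots> = (if n = 0 then - B 0 $$ (i, b) else 0)"
      by (auto simp: Suc_nat_eq_nat_zadd1 simp del: B_Suc)
    finally show ?thesis
      using ib by (auto simp: carrier_matD[OF pencil_carrier(2)] pencil_index poly_at_inf_nth coeff_pCons split: nat.splits)
  qed
  then show "(shifted * resolvent) $$ (i, b) = map_mat poly_at_inf (- B\<^sub>p) $$ (i, b)"
    by (simp add: fls_eq_iff)
qed (simp_all add: carrier_matD[OF pencil_carrier(2)] carrier_matD[OF shifted_carrier] carrier_matD[OF resolvent_carrier])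

lemma poly_at_inf_A\<^sub>p: "map_mat poly_at_inf A\<^sub>p = shifted * map_mat fls_const E"
proof -
  have E': "map_mat fls_const E \<in> carrier_mat d d"
    using E by simp
  show ?thesis
    unfolding shifted_mult[OF E'] fls_const_hom.mat_hom_mult[OF F E(1), symmetric]
    using carrier_matD[OF F] carrier_matD[OF E(1)] carrier_matD[OF pencil_carrier(1)]
    by (intro eq_matI) (simp_all add: pencil_index poly_at_inf_pCons fls_const_uminus del: index_mult_mat(1))
qed

lemma poly_at_inf_C\<^sub>p: "map_mat poly_at_inf C\<^sub>p = map_mat fls_const (C 0) * map_mat fls_const E"
  unfolding fls_const_hom.mat_hom_mult[OF C E(1), symmetric]
  using carrier_matD[OF C] carrier_matD[OF E(1)] carrier_matD[OF pencil_carrier(3)]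
  by (intro eq_matI) (simp_all add: pencil_index poly_at_inf_const del: index_mult_mat(1))

lemma transfer_function_eq:
  assumes R: "R \<in> carrier_mat m m" and "strictly_proper R"
    and markov: "\<And>i. laurent_coeff R (Suc i) = C 0 * B i"
  shows "transfer_function A\<^sub>p (- B\<^sub>p) C\<^sub>p (0\<^sub>m m m) = R"
proof -
  let ?c = "map_mat fls_const" and ?l = "map_mat laurent_at_inf"
  define Ai where "Ai = the (mat_inverse (rat_of_pmat A\<^sub>p))"
  have "det (rat_of_pmat A\<^sub>p) \<noteq> 0"
    using A\<^sub>p_regular by (simp add: rat_of_pmat_def)
  then have Ai: "Ai \<in> carrier_mat d d" "Ai * rat_of_pmat A\<^sub>p = 1\<^sub>m d"
    unfolding Ai_def using mat_inverse_invertible[of "rat_of_pmat A\<^sub>p" d] by simp_all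
  have cE: "?c E \<in> carrier_mat d d" "?c E' \<in> carrier_mat d d" and cC: "?c (C 0) \<in> carrier_mat m d"
    using E C by simp_all
  have lAi: "?l Ai \<in> carrier_mat d d"
    using Ai by simp
  have cEE': "?c E * ?c E' = 1\<^sub>m d"
    unfolding fls_const_hom.mat_hom_mult[OF E(1,2), symmetric] E(3) by (rule fls_const_hom.mat_hom_one)
  \<comment> \<open>\<open>W\<close> solves the equation with coefficient matrix
    \<open>A\<^sub>p\<close> and right-hand side \<open>- B\<^sub>p\<close> over the Laurent series.
    Applying the image of the rational inverse \<open>Ai\<close> to it gives \<open>W\<close>, so
    \<open>Ai\<close> need never be computed.\<close>
  define W where "W = ?c E' * resolvent"
  have W: "W \<in> carrier_mat d m"
    unfolding W_def using cE(2) resolvent_carrier by (rule mult_carrier_mat)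
  have EW: "?c E * W = resolvent"
    unfolding W_def using assoc_mult_mat[OF cE resolvent_carrier] resolvent_carrier
    by (simp only: cEE' left_mult_one_mat)
  have lR: "?c (C 0) * resolvent = ?l R"
  proof (rule eq_matI)
    fix a b assume "a < dim_row (?l R)" "b < dim_col (?l R)"
    then have ab: "a < m" "b < m"
      using R by simp_all
    have "R $$ (a, b) \<in> elements_mat R"
      using ab R by auto
    then have sp: "fls_nth (laurent_at_inf (R $$ (a, b))) n = 0" if "n \<le> 0" for n
      using \<open>strictly_proper R\<close> that unfolding strictly_proper_def by (intro laurent_strictly_proper_nth) auto
    have "fls_nth (laurent_at_inf (R $$ (a, b))) n = (C 0 * B (nat (n - 1))) $$ (a, b)" if "n \<ge> 1" for n
    proof -
      have "laurent_coeff R (Suc (nat (n - 1))) $$ (a, b) = fls_nth (laurent_at_inf (R $$ (a, b))) n"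
        using ab R that by (simp add: laurent_coeff_def)
      then show ?thesis
        by (simp only: markov)
    qed
    then show "(?c (C 0) * resolvent) $$ (a, b) = ?l R $$ (a, b)"
      using ab R sp by (simp add: fls_eq_iff const_mult_resolvent_nth[OF C] del: index_mult_mat(1))
  qed (use R in \<open>simp_all add: carrier_matD[OF C] carrier_matD[OF resolvent_carrier]\<close>)
  have carr: "rat_of_pmat C\<^sub>p \<in> carrier_mat m d" "rat_of_pmat (- B\<^sub>p) \<in> carrier_mat d m"
    "rat_of_pmat A\<^sub>p \<in> carrier_mat d d"
    by simp_all
  note CA = mult_carrier_mat[OF carr(1) Ai(1)]
  have "?l Ai * map_mat poly_at_inf (- B\<^sub>p) = ?l Ai * (shifted * (?c E * W))"
    by (simp only: shifted_mult_resolvent EW)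
  also have "\<dots> = ?l Ai * (map_mat poly_at_inf A\<^sub>p * W)"
    using assoc_mult_mat[OF shifted_carrier cE(1) W] by (simp only: poly_at_inf_A\<^sub>p)
  also have "\<dots> = ?l (Ai * rat_of_pmat A\<^sub>p) * W"
    using assoc_mult_mat[OF lAi _ W, of "map_mat poly_at_inf A\<^sub>p"]
    by (simp add: laurent_at_inf.mat_hom_mult[OF Ai(1) carr(3)] map_mat_laurent_rat_of_pmat)
  also have "\<dots> = W"
    using W by (simp add: Ai(2) laurent_at_inf.mat_hom_one)
  finally have AB: "?l Ai * map_mat poly_at_inf (- B\<^sub>p) = W" .
  have "?l (rat_of_pmat C\<^sub>p * Ai * rat_of_pmat (- B\<^sub>p)) =
      map_mat poly_at_inf C\<^sub>p * ?l Ai * map_mat poly_at_inf (- B\<^sub>p)"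
    by (simp only: laurent_at_inf.mat_hom_mult[OF CA carr(2)] laurent_at_inf.mat_hom_mult[OF carr(1) Ai(1)]
        map_mat_laurent_rat_of_pmat)
  also have "\<dots> = map_mat poly_at_inf C\<^sub>p * (?l Ai * map_mat poly_at_inf (- B\<^sub>p))"
    using lAi by (intro assoc_mult_mat[of _ m d _ d _ m]) auto
  also have "\<dots> = ?c (C 0) * ?c E * W"
    by (simp only: AB poly_at_inf_C\<^sub>p)
  also have "\<dots> = ?l R"
    using assoc_mult_mat[OF cC cE(1) W] by (simp only: EW lR)
  \<comment> \<open>The expansion at infinity is injective, being a field homomorphism.\<close>
  finally have "rat_of_pmat C\<^sub>p * Ai * rat_of_pmat (- B\<^sub>p) = R"
    by (rule laurent_at_inf.mat_hom_inj)
  moreover have "rat_of_pmat (0\<^sub>m m m) = 0\<^sub>m m m"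
    by (intro eq_matI) (simp_all add: rat_of_pmat_def)
  ultimately show ?thesis
    using R by (simp add: transfer_function_def Ai_def)
qed

lemma strongly_minimal_linearization:
  assumes "R \<in> carrier_mat m m" and "strictly_proper R"
    and "\<And>i. laurent_coeff R (Suc i) = C 0 * B i"
  shows "strongly_minimal_linearization d (four_block_mat A\<^sub>p B\<^sub>p C\<^sub>p (0\<^sub>m m m)) R"
proof -
  have "four_block_mat A\<^sub>p B\<^sub>p C\<^sub>p (0\<^sub>m m m) = system_matrix A\<^sub>p (- B\<^sub>p) C\<^sub>p (0\<^sub>m m m)"
    by (simp add: system_matrix_def)
  then show ?thesis
    unfolding strongly_minimal_linearization_def
    using linear_system strongly_minimal transfer_function_eq[OF assms] assms(1) by auto
qed

end

section \<open>Unitary compressions and self-conjugate structures\<close>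

lemma mat_adjoint_dim [simp]: "dim_row (mat_adjoint A) = dim_col A" "dim_col (mat_adjoint A) = dim_row A"
  by (simp_all add: mat_adjoint_def)

lemma mat_adjoint_carrier [simp]: "mat_adjoint A \<in> carrier_mat a b \<longleftrightarrow> A \<in> carrier_mat b a"
  unfolding carrier_mat_def mem_Collect_eq mat_adjoint_dim by (rule conj_commute)

lemma mat_adjoint_index [simp]:
  fixes A :: "complex mat"
  shows "i < dim_col A \<Longrightarrow> j < dim_row A \<Longrightarrow> mat_adjoint A $$ (i, j) = cnj (A $$ (j, i))"
  by (simp add: mat_adjoint_def mat_of_rows_index)

lemma mat_adjoint_mult:
  fixes A B :: "complex mat"
  assumes A: "A \<in> carrier_mat a b" and B: "B \<in> carrier_mat b c"
  shows "mat_adjoint (A * B) = mat_adjoint B * mat_adjoint A"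
proof (rule eq_matI)
  fix i j assume "i < dim_row (mat_adjoint B * mat_adjoint A)" "j < dim_col (mat_adjoint B * mat_adjoint A)"
  then have ij: "i < c" "j < a"
    using A B by simp_all
  have "mat_adjoint (A * B) $$ (i, j) = cnj ((A * B) $$ (j, i))"
    using A B ij by (simp del: index_mult_mat(1))
  also have "\<dots> = (\<Sum>k<b. mat_adjoint B $$ (i, k) * mat_adjoint A $$ (k, j))"
    using A B ij by (subst index_mult_mat_sum[OF A B]) (auto simp: mult.commute)
  also have "\<dots> = (mat_adjoint B * mat_adjoint A) $$ (i, j)"
    using A B ij by (intro index_mult_mat_sum[symmetric]) auto
  finally show "mat_adjoint (A * B) $$ (i, j) = (mat_adjoint B * mat_adjoint A) $$ (i, j)" .
qed (use A B in auto)

lemma mat_adjoint_adjoint [simp]: "mat_adjoint (mat_adjoint A) = (A :: complex mat)"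
  by (intro eq_matI) simp_all

lemma mat_adjoint_congruence:
  fixes M V :: "complex mat"
  assumes V: "V \<in> carrier_mat n d" and M: "M \<in> carrier_mat n n" and adj: "mat_adjoint M = c \<cdot>\<^sub>m M"
  shows "mat_adjoint (mat_adjoint V * M * V) = c \<cdot>\<^sub>m (mat_adjoint V * M * V)"
proof -
  have V': "mat_adjoint V \<in> carrier_mat d n"
    using V by simp
  have "mat_adjoint (mat_adjoint V * M * V) = mat_adjoint V * (c \<cdot>\<^sub>m M * V)"
    using mat_adjoint_mult[OF mult_carrier_mat[OF V' M] V] mat_adjoint_mult[OF V' M] adj
    by (simp add: assoc_mult_mat[OF V' smult_carrier_mat[OF M] V])
  also have "\<dots> = c \<cdot>\<^sub>m (mat_adjoint V * M * V)"
    using mult_smult_distrib[OF V' mult_carrier_mat[OF M V], of c]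
    by (simp add: mult_smult_assoc_mat[OF M V] assoc_mult_mat[OF V' M V])
  finally show ?thesis .
qed

text \<open>Turns the selection of leading rows or columns into a matrix product, so that it obeys
  associativity.\<close>

definition embed_mat :: "nat \<Rightarrow> nat \<Rightarrow> complex mat" where
  "embed_mat n d = mat n d (\<lambda>(i, j). if i = j then 1 else 0)"

lemma embed_mat_carrier [simp]: "embed_mat n d \<in> carrier_mat n d"
  by (simp add: embed_mat_def)

lemma mult_embed_mat:
  assumes A: "A \<in> carrier_mat r n" and "d \<le> n"
  shows "A * embed_mat n d = leading_submatrix r d A"
proof (rule eq_matI)
  fix i j assume "i < dim_row (leading_submatrix r d A)" "j < dim_col (leading_submatrix r d A)"
  then have ij: "i < r" "j < d"
    by (simp_all add: leading_submatrix_def)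
  have "(A * embed_mat n d) $$ (i, j) = (\<Sum>k<n. A $$ (i, k) * embed_mat n d $$ (k, j))"
    using A ij by (intro index_mult_mat_sum) auto
  also have "\<dots> = (\<Sum>k<n. if k = j then A $$ (i, k) else 0)"
    using ij by (intro sum.cong) (auto simp: embed_mat_def)
  also have "\<dots> = A $$ (i, j)"
    using ij \<open>d \<le> n\<close> by simp
  finally show "(A * embed_mat n d) $$ (i, j) = leading_submatrix r d A $$ (i, j)"
    using ij by (simp add: leading_submatrix_def)
qed (use A in \<open>simp_all add: leading_submatrix_def carrier_matD[OF embed_mat_carrier]\<close>)

lemma adjoint_embed_mat_mult:
  assumes A: "A \<in> carrier_mat n r" and "d \<le> n"
  shows "mat_adjoint (embed_mat n d) * A = leading_submatrix d r A"
proof -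
  have A': "mat_adjoint A \<in> carrier_mat r n"
    using A by simp
  have "mat_adjoint (embed_mat n d) * A = mat_adjoint (mat_adjoint A * embed_mat n d)"
    by (simp add: mat_adjoint_mult[OF A' embed_mat_carrier])
  also have "\<dots> = leading_submatrix d r A"
    unfolding mult_embed_mat[OF A' \<open>d \<le> n\<close>]
    using A \<open>d \<le> n\<close> by (intro eq_matI) (auto simp: leading_submatrix_def)
  finally show ?thesis .
qed

lemma leading_submatrix_carrier [simp]: "leading_submatrix r c M \<in> carrier_mat r c"
  by (simp add: leading_submatrix_def)

text \<open>The first two identities are stronger than the compression itself: they also carry the
  zero blocks, and they are what later determines the block factors of \<open>H\<close>
  completely.\<close>

lemma unitary_block_decomposition:
  fixes U V H Hhat :: "complex mat"
  assumes U: "U \<in> carrier_mat n n" "unitary_mat U" and V: "V \<in> carrier_mat n n" "unitary_mat V"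
    and H: "H \<in> carrier_mat n n" and Hhat: "Hhat \<in> carrier_mat d d" and dn: "d \<le> n"
    and UHV: "mat_adjoint U * H * V = four_block_mat Hhat (0\<^sub>m d (n - d)) (0\<^sub>m (n - d) d) (0\<^sub>m (n - d) (n - d))"
  defines "U1 \<equiv> leading_submatrix n d U" and "V1 \<equiv> leading_submatrix n d V"
  shows "H * V1 = U1 * Hhat" and "mat_adjoint U1 * H = Hhat * mat_adjoint V1"
    and "mat_adjoint U1 * H * V1 = Hhat"
proof -
  let ?J = "embed_mat n d" and ?J' = "mat_adjoint (embed_mat n d)"
  let ?D = "four_block_mat Hhat (0\<^sub>m d (n - d)) (0\<^sub>m (n - d) d) (0\<^sub>m (n - d) (n - d))"
  have U1: "U1 = U * ?J" and V1: "V1 = V * ?J"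
    unfolding U1_def V1_def using U V dn by (simp_all add: mult_embed_mat)
  have J: "?J \<in> carrier_mat n d" "?J' \<in> carrier_mat d n"
    by simp_all
  have D: "?D \<in> carrier_mat n n"
    using Hhat dn four_block_carrier_mat[OF Hhat, of "0\<^sub>m (n - d) (n - d)" "n - d" "n - d"] by simp
  have U': "mat_adjoint U \<in> carrier_mat n n" and V': "mat_adjoint V \<in> carrier_mat n n"
    using U V by simp_all
  have unit: "U * mat_adjoint U = 1\<^sub>m n" "mat_adjoint U * U = 1\<^sub>m n" "V * mat_adjoint V = 1\<^sub>m n"
    using U V by (auto simp: unitary_mat_def inverts_mat_def)
  \<comment> \<open>This encodes the zero block below \<open>Hhat\<close>.\<close>
  have DJ: "?D * ?J = ?J * Hhat"
  proof -
    have "?J * Hhat = leading_submatrix n d ?D"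
    proof (rule eq_matI)
      fix i j assume "i < dim_row (leading_submatrix n d ?D)" "j < dim_col (leading_submatrix n d ?D)"
      then have ij: "i < n" "j < d"
        by (simp_all add: leading_submatrix_def)
      have "(?J * Hhat) $$ (i, j) = (\<Sum>k<d. ?J $$ (i, k) * Hhat $$ (k, j))"
        using Hhat ij by (intro index_mult_mat_sum) auto
      also have "\<dots> = (\<Sum>k<d. if k = i then Hhat $$ (k, j) else 0)"
        using ij by (intro sum.cong) (auto simp: embed_mat_def)
      finally show "(?J * Hhat) $$ (i, j) = leading_submatrix n d ?D $$ (i, j)"
        using ij Hhat dn by (simp add: leading_submatrix_def)
    qed (use Hhat in \<open>simp_all add: leading_submatrix_def carrier_matD[OF J(1)]\<close>)
    then show ?thesis
      using mult_embed_mat[OF D dn] by simp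
  qed
  \<comment> \<open>This encodes the zero block to the right of \<open>Hhat\<close>.\<close>
  have JD: "?J' * ?D = Hhat * ?J'"
  proof -
    have "Hhat * ?J' = leading_submatrix d n ?D"
    proof (rule eq_matI)
      fix i j assume "i < dim_row (leading_submatrix d n ?D)" "j < dim_col (leading_submatrix d n ?D)"
      then have ij: "i < d" "j < n"
        by (simp_all add: leading_submatrix_def)
      have "(Hhat * ?J') $$ (i, j) = (\<Sum>k<d. Hhat $$ (i, k) * ?J' $$ (k, j))"
        using Hhat ij by (intro index_mult_mat_sum) auto
      also have "\<dots> = (\<Sum>k<d. if k = j then Hhat $$ (i, k) else 0)"
        using ij by (intro sum.cong) (auto simp: embed_mat_def)
      finally show "(Hhat * ?J') $$ (i, j) = leading_submatrix d n ?D $$ (i, j)"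
        using ij Hhat dn by (simp add: leading_submatrix_def)
    qed (use Hhat in \<open>simp_all add: leading_submatrix_def carrier_matD[OF J(1)]\<close>)
    then show ?thesis
      using adjoint_embed_mat_mult[OF D dn] by simp
  qed
  have JJ: "?J' * ?J = 1\<^sub>m d"
    using adjoint_embed_mat_mult[OF embed_mat_carrier dn, of d] dn
    by (auto simp: leading_submatrix_def embed_mat_def intro!: eq_matI)
  have UH: "mat_adjoint U * H \<in> carrier_mat n n"
    using U' H by (rule mult_carrier_mat)
  have "H * V = U * ?D"
    using assoc_mult_mat[OF U(1) UH V(1)] assoc_mult_mat[OF U(1) U' H] H
    by (simp add: unit flip: UHV)
  then show HV1: "H * V1 = U1 * Hhat"
    unfolding U1 V1 using assoc_mult_mat[OF H V(1) J(1)] assoc_mult_mat[OF U(1) D J(1)]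
      assoc_mult_mat[OF U(1) J(1) Hhat] by (simp add: DJ)
  have U1': "mat_adjoint U1 = ?J' * mat_adjoint U" and V1': "mat_adjoint V1 = ?J' * mat_adjoint V"
    unfolding U1 V1 by (rule mat_adjoint_mult[OF U(1) J(1)], rule mat_adjoint_mult[OF V(1) J(1)])
  have "mat_adjoint U * H = ?D * mat_adjoint V"
    using assoc_mult_mat[OF UH V(1) V'] right_mult_one_mat[OF UH] by (simp add: unit flip: UHV)
  then show "mat_adjoint U1 * H = Hhat * mat_adjoint V1"
    unfolding U1' V1' using assoc_mult_mat[OF J(2) U' H] assoc_mult_mat[OF J(2) D V']
      assoc_mult_mat[OF Hhat J(2) V'] by (simp add: JD)
  have U1c: "U1 \<in> carrier_mat n d" and U1c': "mat_adjoint U1 \<in> carrier_mat d n" and V1c: "V1 \<in> carrier_mat n d"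
    by (simp_all add: U1_def V1_def)
  have "mat_adjoint U1 * U1 = ?J' * mat_adjoint U * (U * ?J)"
    by (simp only: U1') (simp only: U1)
  also have "\<dots> = ?J' * (mat_adjoint U * U * ?J)"
    using assoc_mult_mat[OF J(2) U' mult_carrier_mat[OF U(1) J(1)]] assoc_mult_mat[OF U' U(1) J(1)] by simp
  finally have U1U1: "mat_adjoint U1 * U1 = 1\<^sub>m d"
    using left_mult_one_mat[OF J(1)] by (simp add: unit JJ)
  show "mat_adjoint U1 * H * V1 = Hhat"
    using assoc_mult_mat[OF U1c' H V1c] assoc_mult_mat[OF U1c' U1c Hhat] Hhat
    by (simp add: HV1 U1U1)
qed

section \<open>Symmetry of Laurent coefficients and Hankel matrices\<close>

text \<open>Merges the identity (\<open>e = 1\<close>) with \<open>S\<close>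
  (\<open>e = - 1\<close>), so that the two conditions on \<open>U\<close> become one.\<close>

definition sign_power_mat :: "complex \<Rightarrow> nat \<Rightarrow> nat \<Rightarrow> complex mat" where
  "sign_power_mat e m k = mat (k * m) (k * m) (\<lambda>(a, b). if a = b then e ^ (a div m + 1) else 0)"

lemma sign_power_mat_carrier [simp]: "sign_power_mat e m k \<in> carrier_mat (k * m) (k * m)"
  by (simp add: sign_power_mat_def)

lemma sign_power_mat_mult_index:
  assumes A: "A \<in> carrier_mat (k * m) r" and "a < k * m" "b < r"
  shows "(sign_power_mat e m k * A) $$ (a, b) = e ^ (a div m + 1) * A $$ (a, b)"
proof -
  have "(sign_power_mat e m k * A) $$ (a, b) = (\<Sum>i<k * m. sign_power_mat e m k $$ (a, i) * A $$ (i, b))"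
    using assms by (intro index_mult_mat_sum) auto
  also have "\<dots> = (\<Sum>i<k * m. if i = a then e ^ (a div m + 1) * A $$ (i, b) else 0)"
    using assms by (intro sum.cong) (auto simp: sign_power_mat_def)
  finally show ?thesis
    using assms by simp
qed

text \<open>The four structures of the theorem are the cases \<open>e, s \<in> {1, - 1}\<close>.\<close>

definition self_conjugate_rmat :: "complex \<Rightarrow> complex \<Rightarrow> complex poly fract mat \<Rightarrow> bool" where
  "self_conjugate_rmat e s M \<longleftrightarrow> square_mat M \<and>
     (\<forall>z. \<not> pole_at M z \<longrightarrow> \<not> pole_at M (e * cnj z) \<longrightarrow>
        mat_adjoint (eval_rmat M z) = s \<cdot>\<^sub>m eval_rmat M (e * cnj z))"

lemma finite_poles: "finite {z. pole_at M z}"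
proof -
  have "{z. pole_at M z} = (\<Union>r \<in> elements_mat M. {z. poly (denom r) z = 0})"
    by (auto simp: pole_at_def)
  then show ?thesis
    by (simp add: finite_elements_mat poly_roots_finite)
qed

text \<open>Compare coefficients on both sides of the symmetry: reflecting \<lambda> by
  \<open>e\<close> multiplies the coefficient of index n by \<open>e ^ n\<close>.\<close>

lemma laurent_coeff_self_conjugate:
  assumes R: "R \<in> carrier_mat m m" and "self_conjugate_rmat e s R" and e: "e * e = 1" and "a < m" "b < m"
  shows "cnj (laurent_coeff R n $$ (a, b)) = s * e ^ n * laurent_coeff R n $$ (b, a)"
proof -
  let ?X = "{z. pole_at R z} \<union> (\<lambda>z. e * cnj z) -` {z. pole_at R z}"
  have "inj (\<lambda>z. e * cnj z)"
    using e by (auto intro!: injI)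
  then have fin: "finite ?X"
    by (intro finite_UnI finite_vimageI finite_poles)
  have "fls_twist e (laurent_at_inf (R $$ (a, b))) = fls_const s * laurent_at_inf (R $$ (b, a))"
  proof (rule laurent_at_inf_twist[OF e fin])
    fix z assume "z \<notin> ?X"
    then have "mat_adjoint (eval_rmat R z) = s \<cdot>\<^sub>m eval_rmat R (e * cnj z)"
      using assms(2) by (simp add: self_conjugate_rmat_def)
    then have "mat_adjoint (eval_rmat R z) $$ (b, a) = (s \<cdot>\<^sub>m eval_rmat R (e * cnj z)) $$ (b, a)"
      by simp
    then show "cnj (poly (numer (R $$ (a, b))) z / poly (denom (R $$ (a, b))) z) =
        s * (poly (numer (R $$ (b, a))) (e * cnj z) / poly (denom (R $$ (b, a))) (e * cnj z))"
      using R \<open>a < m\<close> \<open>b < m\<close> by (simp add: eval_rmat_def)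
  qed
  from arg_cong[OF this, of "\<lambda>f. fls_nth f (int n)"]
  have "e ^ n * cnj (laurent_coeff R n $$ (a, b)) = s * laurent_coeff R n $$ (b, a)"
    using R \<open>a < m\<close> \<open>b < m\<close> by (simp add: laurent_coeff_def)
  then have "e ^ n * e ^ n * cnj (laurent_coeff R n $$ (a, b)) = s * e ^ n * laurent_coeff R n $$ (b, a)"
    by (simp add: mult_ac)
  then show ?thesis
    using e by (simp flip: power_mult_distrib)
qed

lemma block_hankel_carrier [simp]: "block_hankel t m k R \<in> carrier_mat (k * m) (k * m)"
  by (simp add: block_hankel_def)

text \<open>In block (i, j) the adjoint yields \<open>e ^ (j + 1)\<close> from the sign matrix and
  \<open>e ^ (i + j + t)\<close> from the coefficient. The two factors \<open>e ^ j\<close> cancel,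
  \<open>e ^ (i + 1)\<close> is the sign of block row i, and \<open>e ^ t\<close> is left over:
  \<open>e\<close> for \<open>H\<close>, 1 for \<open>Hs\<close>.\<close>

lemma block_hankel_self_conjugate:
  assumes R: "R \<in> carrier_mat m m" and sc: "self_conjugate_rmat e s R"
    and e: "e * e = 1" "cnj e = e"
  shows "mat_adjoint (sign_power_mat e m k * block_hankel t m k R) =
    (s * e ^ t) \<cdot>\<^sub>m (sign_power_mat e m k * block_hankel t m k R)" (is "mat_adjoint ?M = _ \<cdot>\<^sub>m ?M")
proof (rule eq_matI)
  have M: "?M \<in> carrier_mat (k * m) (k * m)"
    using sign_power_mat_carrier block_hankel_carrier by (rule mult_carrier_mat)
  then show "dim_row (mat_adjoint ?M) = dim_row ((s * e ^ t) \<cdot>\<^sub>m ?M)"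
    "dim_col (mat_adjoint ?M) = dim_col ((s * e ^ t) \<cdot>\<^sub>m ?M)"
    by (simp_all add: carrier_matD[OF M] del: index_mult_mat(2,3))
  fix a b assume "a < dim_row ((s * e ^ t) \<cdot>\<^sub>m ?M)" "b < dim_col ((s * e ^ t) \<cdot>\<^sub>m ?M)"
  then have ab: "a < k * m" "b < k * m"
    by (simp_all add: carrier_matD[OF M] del: index_mult_mat(2,3))
  define i j where "i = a div m" and "j = b div m"
  let ?c = "laurent_coeff R (i + j + t) $$ (a mod m, b mod m)"
  have M_index: "?M $$ (x, y) = e ^ (x div m + 1) * laurent_coeff R (x div m + y div m + t) $$ (x mod m, y mod m)"
    if "x < k * m" "y < k * m" for x y
    using that unfolding sign_power_mat_mult_index[OF block_hankel_carrier that] by (simp add: block_hankel_def)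
  have "mat_adjoint ?M $$ (a, b) = cnj (?M $$ (b, a))"
    using ab by (intro mat_adjoint_index) (simp_all add: carrier_matD[OF M] del: index_mult_mat(2,3))
  also have "\<dots> = e ^ (j + 1) * cnj (laurent_coeff R (i + j + t) $$ (b mod m, a mod m))"
    unfolding M_index[OF ab(2,1)] by (simp add: e i_def j_def add.commute)
  also have "\<dots> = e ^ (j + 1) * (s * e ^ (i + j + t) * ?c)"
    using ab div_mod_bounds(2) by (simp add: laurent_coeff_self_conjugate[OF R sc e(1)])
  also have "\<dots> = s * e ^ t * (e ^ (i + 1) * ?c) * (e ^ j * e ^ j)"
    by (simp add: power_add mult_ac)
  also have "e ^ j * e ^ j = 1"
    using e by (simp flip: power_mult_distrib)
  finally show "mat_adjoint ?M $$ (a, b) = ((s * e ^ t) \<cdot>\<^sub>m ?M) $$ (a, b)"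
    using ab M_index[OF ab] by (simp add: carrier_matD[OF M] i_def j_def del: index_mult_mat(1,2,3))
qed

section \<open>Self-conjugate linearizations\<close>

lemma index_square_four_block_mat:
  assumes "A \<in> carrier_mat d d" "B \<in> carrier_mat d m" "C \<in> carrier_mat m d" "D \<in> carrier_mat m m"
    and "i < d + m" "j < d + m"
  shows "four_block_mat A B C D $$ (i, j) =
    (if i < d then if j < d then A $$ (i, j) else B $$ (i, j - d)
     else if j < d then C $$ (i - d, j) else D $$ (i - d, j - d))"
  using assms by auto

lemma eval_rmat_rat_of_pmat: "eval_rmat (rat_of_pmat P) z = eval_pmat P z"
  by (intro eq_matI) (simp_all add: eval_rmat_def rat_of_pmat_def eval_pmat_def numer_def denom_def)

text \<open>\<open>E\<close> multiplies \<lambda>, so its symmetry must differ from that of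
  \<open>M\<close> by the factor \<open>e\<close> which the reflection of \<lambda> produces. The
  off-diagonal blocks contain \<open>E\<close> but no \<lambda>; there the factor \<open>e\<close>
  in the lower left block compensates.\<close>

lemma self_conjugate_pencil:
  fixes M E N :: "complex mat"
  assumes M: "M \<in> carrier_mat d d" and E: "E \<in> carrier_mat d d" and N: "N \<in> carrier_mat m d"
    and adj_M: "mat_adjoint M = s \<cdot>\<^sub>m M" and adj_E: "mat_adjoint E = (s * e) \<cdot>\<^sub>m E"
    and e: "e * e = 1" "cnj e = e"
  shows "self_conjugate_rmat e s (rat_of_pmat (four_block_mat
    (const_pmat M - [:0, 1:] \<cdot>\<^sub>m const_pmat E) (const_pmat (E * mat_adjoint N))
    (const_pmat (e \<cdot>\<^sub>m (N * E))) (0\<^sub>m m m)))"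
proof -
  let ?A = "const_pmat M - [:0, 1:] \<cdot>\<^sub>m const_pmat E" and ?B = "const_pmat (E * mat_adjoint N)"
    and ?C = "const_pmat (e \<cdot>\<^sub>m (N * E))"
  let ?L = "four_block_mat ?A ?B ?C (0\<^sub>m m m)"
  have N': "mat_adjoint N \<in> carrier_mat d m"
    using N by simp
  note EN = mult_carrier_mat[OF E N'] and NE = mult_carrier_mat[OF N E]
  have c: "?A \<in> carrier_mat d d" "?B \<in> carrier_mat d m" "?C \<in> carrier_mat m d"
    using M E EN NE by (simp_all add: minus_carrier_mat)
  have L: "?L \<in> carrier_mat (d + m) (d + m)"
    by (rule four_block_carrier_mat[OF c(1) zero_carrier_mat])
  have L_index: "eval_pmat ?L z $$ (i, j) =
      (if i < d then if j < d then M $$ (i, j) - z * E $$ (i, j) else (E * mat_adjoint N) $$ (i, j - d)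
       else if j < d then e * (N * E) $$ (i - d, j) else 0)" if ij: "i < d + m" "j < d + m" for i j z
  proof -
    have "eval_pmat ?L z $$ (i, j) = poly (?L $$ (i, j)) z"
      using ij carrier_matD[OF L] by (simp add: eval_pmat_def del: index_mat_four_block)
    moreover have "\<not> i < d \<Longrightarrow> i - d < m" "\<not> j < d \<Longrightarrow> j - d < m"
      using ij by auto
    ultimately show ?thesis
      unfolding index_square_four_block_mat[OF c zero_carrier_mat ij]
      using ij carrier_matD[OF M] carrier_matD[OF E] carrier_matD[OF EN] carrier_matD[OF NE]
      by (simp add: const_pmat_def del: index_mult_mat)
  qed
  have adj_EN: "mat_adjoint (E * mat_adjoint N) = (s * e) \<cdot>\<^sub>m (N * E)"
    using mult_smult_distrib[OF N E, of "s * e"] by (simp add: mat_adjoint_mult[OF E N'] adj_E)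
  have cnj_M: "cnj (M $$ (j, i)) = s * M $$ (i, j)" if "i < d" "j < d" for i j
    using arg_cong[OF adj_M, of "\<lambda>M. M $$ (i, j)"] M that by simp
  have cnj_E: "cnj (E $$ (j, i)) = s * e * E $$ (i, j)" if "i < d" "j < d" for i j
    using arg_cong[OF adj_E, of "\<lambda>M. M $$ (i, j)"] E that by simp
  have cnj_EN: "cnj ((E * mat_adjoint N) $$ (j, i)) = s * e * (N * E) $$ (i, j)" if "i < m" "j < d" for i j
    using arg_cong[OF adj_EN, of "\<lambda>M. M $$ (i, j)"] carrier_matD[OF EN] carrier_matD[OF NE] that
    by (simp del: index_mult_mat)
  have adj_NE: "mat_adjoint (N * E) = (s * e) \<cdot>\<^sub>m (E * mat_adjoint N)"
    using mult_smult_assoc_mat[OF E N', of "s * e"] by (simp add: mat_adjoint_mult[OF N E] adj_E)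
  have cnj_NE: "cnj ((N * E) $$ (j, i)) = s * e * (E * mat_adjoint N) $$ (i, j)" if "i < d" "j < m" for i j
    using arg_cong[OF adj_NE, of "\<lambda>M. M $$ (i, j)"] carrier_matD[OF EN] carrier_matD[OF NE] that
    by (simp del: index_mult_mat)
  have ee: "e * (s * e * x) = s * x" for x
    using e(1) by (metis (no_types, opaque_lifting) mult.assoc mult.commute mult_1)
  have "mat_adjoint (eval_pmat ?L z) = s \<cdot>\<^sub>m eval_pmat ?L (e * cnj z)" for z
  proof (rule eq_matI)
    have dims: "dim_row (eval_pmat ?L z) = d + m" "dim_col (eval_pmat ?L z) = d + m" for z
      using carrier_matD[OF L] by (simp_all add: eval_pmat_def)
    fix i j assume "i < dim_row (s \<cdot>\<^sub>m eval_pmat ?L (e * cnj z))" "j < dim_col (s \<cdot>\<^sub>m eval_pmat ?L (e * cnj z))"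
    then have ij: "i < d + m" "j < d + m"
      by (simp_all add: dims)
    have "mat_adjoint (eval_pmat ?L z) $$ (i, j) = cnj (eval_pmat ?L z $$ (j, i))"
      using ij by (intro mat_adjoint_index) (simp_all add: dims)
    also have "\<dots> = s * eval_pmat ?L (e * cnj z) $$ (i, j)"
      unfolding L_index[OF ij] L_index[OF ij(2,1)]
      using ij by (auto simp: cnj_M cnj_E cnj_EN cnj_NE e ee right_diff_distrib mult_ac simp del: index_mult_mat)
    finally show "mat_adjoint (eval_pmat ?L z) $$ (i, j) = (s \<cdot>\<^sub>m eval_pmat ?L (e * cnj z)) $$ (i, j)"
      using ij by (simp add: dims)
  qed (simp_all add: eval_pmat_def carrier_matD[OF c(1)] del: index_minus_mat)
  moreover have "square_mat (rat_of_pmat ?L)"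
    using carrier_matD[OF L] by (simp add: rat_of_pmat_def del: index_mat_four_block)
  ultimately show ?thesis
    unfolding self_conjugate_rmat_def eval_rmat_rat_of_pmat by blast
qed

text \<open>The symmetry claims follow from the Hankel symmetry by congruence with
  \<open>V1\<close>. For the linearization, the pencil is identified block by block with that of a
  minimal realization.\<close>

lemma self_conjugate_linearization:
  fixes R :: "complex poly fract mat" and U V Hhat :: "complex mat"
  assumes R: "R \<in> carrier_mat m m" and sp: "strictly_proper R"
    and polar: "finite_polar_degree R d"
    and sc: "self_conjugate_rmat e s R" and e: "e * e = 1" "cnj e = e"
    and V: "V \<in> carrier_mat (k * m) (k * m)" "unitary_mat V"
    and U: "U = sign_power_mat e m k * V" "unitary_mat U"
    and Hhat: "Hhat \<in> carrier_mat d d" "invertible_mat Hhat"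
    and UHV: "mat_adjoint U * hankel m k R * V = four_block_mat Hhat (0\<^sub>m d (k * m - d))
      (0\<^sub>m (k * m - d) d) (0\<^sub>m (k * m - d) (k * m - d))"
  defines "V1 \<equiv> leading_submatrix (k * m) d V"
  defines "V11 \<equiv> leading_submatrix m d V1"
  defines "SHs \<equiv> sign_power_mat e m k * hankel_shifted m k R"
  defines "L \<equiv> four_block_mat
    (const_pmat (mat_adjoint V1 * SHs * V1) - [:0, 1:] \<cdot>\<^sub>m const_pmat Hhat)
    (const_pmat (Hhat * mat_adjoint V11)) (const_pmat (e \<cdot>\<^sub>m (V11 * Hhat))) (0\<^sub>m m m)"
  shows "mat_adjoint Hhat = (s * e) \<cdot>\<^sub>m Hhat" and "mat_adjoint SHs = s \<cdot>\<^sub>m SHs"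
    and "self_conjugate_rmat e s (rat_of_pmat L)" and "strongly_minimal_linearization d L R"
proof -
  let ?n = "k * m" and ?S = "sign_power_mat e m k"
  let ?H = "hankel m k R" and ?Hs = "hankel_shifted m k R"
  define U1 where "U1 = leading_submatrix ?n d U"
  have S: "?S \<in> carrier_mat ?n ?n" and H: "?H \<in> carrier_mat ?n ?n" and Hs: "?Hs \<in> carrier_mat ?n ?n"
    by (simp_all add: hankel_def hankel_shifted_def)
  have Uc: "U \<in> carrier_mat ?n ?n"
    unfolding U(1) using S V(1) by (rule mult_carrier_mat)
  \<comment> \<open>Subtraction truncates here, but the block matrix has as many rows as
    \<open>U\<close> has columns, which excludes \<open>d > k * m\<close>.\<close>
  have dn: "d \<le> ?n"
  proof -
    have "d + (?n - d) = dim_row (mat_adjoint U * ?H * V)"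
      using Hhat(1) by (simp only: UHV index_mat_four_block(2)) simp
    then show ?thesis
      using Uc by simp
  qed
  note blocks = unitary_block_decomposition[OF Uc U(2) V H Hhat(1) dn UHV,
      folded U1_def V1_def]
  have V1: "V1 \<in> carrier_mat ?n d" "mat_adjoint V1 \<in> carrier_mat d ?n"
    and V11: "V11 \<in> carrier_mat m d" and U1: "U1 \<in> carrier_mat ?n d" "mat_adjoint U1 \<in> carrier_mat d ?n"
    by (simp_all add: V1_def V11_def U1_def)
  have U1_V1: "U1 = ?S * V1"
    unfolding U1_def V1_def U(1)
    using mult_embed_mat[OF mult_carrier_mat[OF S V(1)] dn] mult_embed_mat[OF V(1) dn]
      assoc_mult_mat[OF S V(1) embed_mat_carrier] by simp
  have adj_S: "mat_adjoint ?S = ?S"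
    using e(2) by (intro eq_matI) (auto simp: sign_power_mat_def)
  \<comment> \<open>Turns the two-sided compression by \<open>U1\<close> and \<open>V1\<close> into
    a congruence by \<open>V1\<close> alone.\<close>
  have adj_U1: "mat_adjoint U1 = mat_adjoint V1 * ?S"
    unfolding U1_V1 by (simp add: mat_adjoint_mult[OF S V1(1)] adj_S)
  have SHs: "SHs \<in> carrier_mat ?n ?n"
    unfolding SHs_def using S Hs by (rule mult_carrier_mat)
  have U1_Hs_V1: "mat_adjoint V1 * SHs * V1 = mat_adjoint U1 * ?Hs * V1"
    unfolding SHs_def adj_U1 using assoc_mult_mat[OF V1(2) S Hs] by simp
  have Hhat_eq: "Hhat = mat_adjoint V1 * (?S * ?H) * V1"
    using blocks(3) unfolding adj_U1 using assoc_mult_mat[OF V1(2) S H] by simp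
  have "mat_adjoint (?S * ?H) = (s * e) \<cdot>\<^sub>m (?S * ?H)"
    using block_hankel_self_conjugate[OF R sc e, of k 1] by (simp add: hankel_def)
  from mat_adjoint_congruence[OF V1(1) mult_carrier_mat[OF S H] this]
  show adj_Hhat: "mat_adjoint Hhat = (s * e) \<cdot>\<^sub>m Hhat"
    by (simp only: Hhat_eq[symmetric])
  have ee: "e ^ 2 = 1"
    using e(1) by (simp add: power2_eq_square)
  show adj_SHs: "mat_adjoint SHs = s \<cdot>\<^sub>m SHs"
    using block_hankel_self_conjugate[OF R sc e, of k 2] unfolding SHs_def hankel_shifted_def by (simp add: ee)
  have adj_M: "mat_adjoint (mat_adjoint V1 * SHs * V1) = s \<cdot>\<^sub>m (mat_adjoint V1 * SHs * V1)"
    by (rule mat_adjoint_congruence[OF V1(1) SHs adj_SHs])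
  have "mat_adjoint V1 * SHs * V1 \<in> carrier_mat d d"
    by (rule mult_carrier_mat[OF mult_carrier_mat[OF V1(2) SHs] V1(1)])
  then show "self_conjugate_rmat e s (rat_of_pmat L)"
    unfolding L_def using Hhat(1) V11 adj_M adj_Hhat e by (rule self_conjugate_pencil)

  obtain Hi where "inverts_mat Hhat Hi" "inverts_mat Hi Hhat"
    using Hhat(2) by (auto simp: invertible_mat_def)
  then have Hi: "Hi \<in> carrier_mat d d" "Hhat * Hi = 1\<^sub>m d" "Hi * Hhat = 1\<^sub>m d"
    using Hhat(1) unfolding inverts_mat_def
    by (metis carrier_matD carrier_matI index_mult_mat(3) index_one_mat(3))+
  obtain C' B' where C': "\<And>i. C' i \<in> carrier_mat m d" and B': "\<And>j. B' j \<in> carrier_mat d m"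
    and CB': "\<And>i j. laurent_coeff R (i + j + 1) = C' i * B' j"
    using finite_polar_degree_factors[OF R polar] by blast
  \<comment> \<open>Kept general in \<open>C\<close> and \<open>B\<close>, since it serves both
    before and after the change of state coordinates.\<close>
  have hankel_fact: "?H = block_col k m d C * block_row k m d B" "?Hs = block_col k m d (\<lambda>i. C (Suc i)) * block_row k m d B"
    if "\<And>i. C i \<in> carrier_mat m d" "\<And>j. B j \<in> carrier_mat d m" "\<And>i j. laurent_coeff R (i + j + 1) = C i * B j" for C B
  proof -
    have "laurent_coeff R (i + j + 2) = C (Suc i) * B j" for i j
      using that(3)[of "Suc i" j] by simp
    then show "?H = block_col k m d C * block_row k m d B" "?Hs = block_col k m d (\<lambda>i. C (Suc i)) * block_row k m d B"
      using that by (simp_all only: block_col_mult_block_row hankel_def hankel_shifted_def block_hankel_def that)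
  qed
  \<comment> \<open>\<open>X\<close> and \<open>Y\<close> are square because the inner dimension of
    the factorization equals the size of \<open>Hhat\<close>.\<close>
  define X where "X = mat_adjoint U1 * block_col k m d C'"
  define Y where "Y = block_row k m d B' * V1"
  have X: "X \<in> carrier_mat d d" and Y: "Y \<in> carrier_mat d d"
    unfolding X_def Y_def using mult_carrier_mat[OF U1(2) block_carrier(1)] mult_carrier_mat[OF block_carrier(2) V1(1)] by auto
  have XY: "X * Y = Hhat"
    unfolding X_def Y_def blocks(3)[symmetric] hankel_fact(1)[OF C' B' CB']
    using assoc_mult_mat[OF mult_carrier_mat[OF U1(2) block_carrier(1)] block_carrier(2) V1(1)]
      assoc_mult_mat[OF U1(2) block_carrier(1) block_carrier(2)] by simp
  define X' where "X' = Y * Hi"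
  have X': "X' \<in> carrier_mat d d"
    unfolding X'_def using Y Hi(1) by (rule mult_carrier_mat)
  have XX': "X * X' = 1\<^sub>m d"
    unfolding X'_def using assoc_mult_mat[OF X Y Hi(1)] Hi(2) by (simp add: XY)
  then have X'X: "X' * X = 1\<^sub>m d"
    by (rule mat_mult_left_right_inverse[OF X X'])

  \<comment> \<open>Change of state coordinates by \<open>X\<close>, normalized so that the adjoint
    of \<open>U1\<close> is a left inverse of the block column; the block row times
    \<open>V1\<close> then becomes \<open>Hhat\<close>.\<close>
  define B where "B j = X * B' j" for j
  define C where "C i = C' i * X'" for i
  have B: "B j \<in> carrier_mat d m" and C: "C i \<in> carrier_mat m d" for i j
    unfolding B_def C_def using mult_carrier_mat[OF X B'] mult_carrier_mat[OF C' X'] by auto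
  have CB: "laurent_coeff R (i + j + 1) = C i * B j" for i j
  proof -
    have "C i * B j = C' i * (X' * X * B' j)"
      unfolding B_def C_def
      using assoc_mult_mat[OF C' X' mult_carrier_mat[OF X B']] assoc_mult_mat[OF X' X B'] by simp
    then show ?thesis
      using left_mult_one_mat[OF B'] by (simp only: X'X CB')
  qed
  let ?C = "block_col k m d C" and ?B = "block_row k m d B"
  note Cc = block_carrier(1)[of k m d C] and Bc = block_carrier(2)[of k m d B]
  note H_eq = hankel_fact(1)[OF C B CB] and Hs_eq = hankel_fact(2)[OF C B CB]
  have U1C: "mat_adjoint U1 * ?C = 1\<^sub>m d"
    unfolding C_def block_col_mult[OF C' X', symmetric]
    by (simp only: assoc_mult_mat[OF U1(2) block_carrier(1) X', symmetric] X_def[symmetric] XX')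
  have BV1: "?B * V1 = Hhat"
    unfolding B_def mult_block_row[OF B' X, symmetric]
    using assoc_mult_mat[OF X block_carrier(2) V1(1)] by (simp add: XY flip: Y_def)
  have G: "V1 * Hi \<in> carrier_mat ?n d" "?B * (V1 * Hi) = 1\<^sub>m d"
    using mult_carrier_mat[OF V1(1) Hi(1)] assoc_mult_mat[OF Bc V1(1) Hi(1)]
    by (simp_all add: BV1 Hi(2))
  have shift: "C (Suc i) * B j = C i * B (Suc j)" for i j
    using CB[of "Suc i" j] CB[of i "Suc j"] by simp
  obtain F where F: "F \<in> carrier_mat d d" and C_Suc: "\<And>i. C (Suc i) = C i * F" and B_Suc: "\<And>j. B (Suc j) = F * B j"
    using hankel_realization[OF C B shift U1(2) U1C G] by blast
  interpret minimal_realization k m d F B C "mat_adjoint U1" "V1 * Hi" Hhat Hi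
    by unfold_locales (fact F B C B_Suc C_Suc U1(2) U1C G Hhat(1) Hi)+

  \<comment> \<open>Shifting the Hankel matrix inserts \<open>F\<close> between its factors, and the
    normalization evaluates what stands on either side of it.\<close>
  have "mat_adjoint V1 * SHs * V1 = F * Hhat"
  proof -
    have "?Hs = ?C * F * ?B"
      using block_col_mult[OF C F, of k] by (simp add: Hs_eq C_Suc)
    then have "mat_adjoint U1 * ?Hs = mat_adjoint U1 * ?C * F * ?B"
      using assoc_mult_mat[OF U1(2) mult_carrier_mat[OF Cc F] Bc] assoc_mult_mat[OF U1(2) Cc F] by simp
    also have "\<dots> = F * ?B"
      using F by (simp add: U1C)
    finally show ?thesis
      using assoc_mult_mat[OF F Bc V1(1)] by (simp add: U1_Hs_V1 BV1)
  qed
  then have A: "const_pmat (mat_adjoint V1 * SHs * V1) - [:0, 1:] \<cdot>\<^sub>m const_pmat Hhat = A\<^sub>p"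
    by (simp add: A\<^sub>p_def)

  \<comment> \<open>If \<open>d > 0\<close>, the bound on \<open>d\<close> forces
    \<open>k > 0\<close>, so the first \<open>m\<close> rows lie inside \<open>V1\<close>; if
    \<open>d = 0\<close>, the blocks compared below have no entries.\<close>
  have k_pos: "0 < k" if "0 < d"
    using that dn by (cases k) auto
  have le_n: "a < ?n" if "a < m" "0 < d" for a
    using that k_pos[OF that(2)] by (metis One_nat_def Suc_leI less_le_trans mult_le_mono1 nat_mult_1)
  \<comment> \<open>Here the zero block to the right of \<open>Hhat\<close> is used; the first block
    of this row gives the upper right block of the pencil.\<close>
  have "?B = Hhat * mat_adjoint V1"
    using blocks(2) assoc_mult_mat[OF U1(2) Cc Bc] left_mult_one_mat[OF Bc] by (simp add: H_eq U1C)
  have B_eq: "Hhat * mat_adjoint V11 = B 0"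
  proof (rule eq_matI)
    fix t b assume "t < dim_row (B 0)" "b < dim_col (B 0)"
    then have tb: "t < d" "b < m" and bn: "b < ?n"
      using carrier_matD[OF B[of 0]] le_n[of b] by auto
    have "B 0 $$ (t, b) = ?B $$ (t, b)"
      using tb bn by (simp add: block_row_def)
    also have "\<dots> = (\<Sum>i<d. Hhat $$ (t, i) * mat_adjoint V1 $$ (i, b))"
      unfolding \<open>?B = _\<close> using tb bn Hhat V1 by (intro index_mult_mat_sum[of _ d d _ ?n]) auto
    also have "\<dots> = (\<Sum>i<d. Hhat $$ (t, i) * mat_adjoint V11 $$ (i, b))"
      using tb bn V1 V11 by (intro sum.cong) (auto simp: V11_def leading_submatrix_def)
    also have "\<dots> = (Hhat * mat_adjoint V11) $$ (t, b)"
      using tb Hhat V11 by (intro index_mult_mat_sum[symmetric]) auto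
    finally show "(Hhat * mat_adjoint V11) $$ (t, b) = B 0 $$ (t, b)" ..
  qed (use Hhat V11 carrier_matD[OF B[of 0]] in auto)

  \<comment> \<open>Here the zero block below \<open>Hhat\<close> is used; cancelling
    \<open>Hhat\<close> leaves \<open>U1\<close>.\<close>
  have "?C * Hhat = U1 * Hhat"
    using blocks(1) assoc_mult_mat[OF Cc Bc V1(1)]
    by (simp add: H_eq BV1)
  then have "?C * Hhat * Hi = U1 * Hhat * Hi"
    by simp
  then have C_U1: "?C = U1"
    using assoc_mult_mat[OF Cc Hhat(1) Hi(1)] assoc_mult_mat[OF U1(1) Hhat(1) Hi(1)]
      right_mult_one_mat[OF Cc] right_mult_one_mat[OF U1(1)] by (simp add: Hi(2))
  \<comment> \<open>The first block of \<open>U1\<close> is \<open>e\<close> times that of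
    \<open>V1\<close>, since the sign exponents start at 1. This is the origin of the minus sign in
    the lower left block of the para cases.\<close>
  have "e \<cdot>\<^sub>m V11 = C 0"
  proof (rule eq_matI)
    fix a t assume "a < dim_row (C 0)" "t < dim_col (C 0)"
    then have at: "a < m" "t < d" and an: "a < ?n"
      using carrier_matD[OF C[of 0]] le_n[of a] by auto
    have "C 0 $$ (a, t) = ?C $$ (a, t)"
      using at an by (simp add: block_col_def)
    also have "\<dots> = e * V1 $$ (a, t)"
      unfolding C_U1 U1_V1 sign_power_mat_mult_index[OF V1(1) an at(2)] using at by simp
    finally show "(e \<cdot>\<^sub>m V11) $$ (a, t) = C 0 $$ (a, t)"
      using at by (simp add: V11_def leading_submatrix_def)
  qed (use V11 carrier_matD[OF C[of 0]] in auto)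
  then have C_eq: "e \<cdot>\<^sub>m (V11 * Hhat) = C 0 * Hhat"
    using mult_smult_assoc_mat[OF V11 Hhat(1), of e] by simp
  have "L = four_block_mat A\<^sub>p B\<^sub>p C\<^sub>p (0\<^sub>m m m)"
    unfolding L_def A B_eq C_eq by (simp add: B\<^sub>p_def C\<^sub>p_def)
  moreover have "laurent_coeff R (Suc i) = C 0 * B i" for i
    using CB[of 0 i] by simp
  ultimately show "strongly_minimal_linearization d L R"
    using strongly_minimal_linearization[OF R sp] by simp
qed

section \<open>Specialization to the four structures\<close>

lemma smult_minus_one_mat: "(- 1) \<cdot>\<^sub>m M = - (M :: complex mat)"
  by (intro eq_matI) auto

lemma smult_one_mat: "1 \<cdot>\<^sub>m M = (M :: complex mat)"
  by (intro eq_matI) auto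

lemma self_conjugate_rmat_iff:
  "self_conjugate_rmat 1 1 M \<longleftrightarrow> hermitian_rmat M"
  "self_conjugate_rmat 1 (- 1) M \<longleftrightarrow> skew_hermitian_rmat M"
  "self_conjugate_rmat (- 1) 1 M \<longleftrightarrow> para_hermitian_rmat M"
  "self_conjugate_rmat (- 1) (- 1) M \<longleftrightarrow> para_skew_hermitian_rmat M"
  by (simp_all add: self_conjugate_rmat_def hermitian_rmat_def skew_hermitian_rmat_def
      para_hermitian_rmat_def para_skew_hermitian_rmat_def smult_minus_one_mat smult_one_mat)

lemma sign_power_mat_simps:
  "sign_power_mat 1 m k = 1\<^sub>m (k * m)" "sign_power_mat (- 1) m k = sign_mat m k"
  by (auto simp: sign_power_mat_def sign_mat_def intro!: eq_matI)

theorem theorem6p2: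
  fixes R :: "complex poly fract mat"
    and m k rf :: nat
    and H Hs S U V Hhat V1 V11 :: "complex mat"
    and L Lpara :: "complex poly mat"
  assumes "R \<in> carrier_mat m m"
    and "strictly_proper R"
    and "H = hankel m k R"
    and "Hs = hankel_shifted m k R"
    and "rf = mrank H"
    and "finite_polar_degree R rf"
    and "S = sign_mat m k"
    and "U \<in> carrier_mat (k * m) (k * m)" and "unitary_mat U"
    and "V \<in> carrier_mat (k * m) (k * m)" and "unitary_mat V"
    and "Hhat \<in> carrier_mat rf rf" and "invertible_mat Hhat"
    and "mat_adjoint U * H * V =
           four_block_mat Hhat (0\<^sub>m rf (k * m - rf))
             (0\<^sub>m (k * m - rf) rf) (0\<^sub>m (k * m - rf) (k * m - rf))"
    and "V1 = leading_submatrix (k * m) rf V"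
    and "V11 = leading_submatrix m rf V1"
    and "L = four_block_mat
           (const_pmat (mat_adjoint V1 * Hs * V1) - [:0, 1:] \<cdot>\<^sub>m const_pmat Hhat)
           (const_pmat (Hhat * mat_adjoint V11))
           (const_pmat (V11 * Hhat))
           (0\<^sub>m m m)"
    and "Lpara = four_block_mat
           (const_pmat (mat_adjoint V1 * (S * Hs) * V1) - [:0, 1:] \<cdot>\<^sub>m const_pmat Hhat)
           (const_pmat (Hhat * mat_adjoint V11))
           (const_pmat (- (V11 * Hhat)))
           (0\<^sub>m m m)"
  shows "(hermitian_rmat R \<and> U = V \<longrightarrow>
            mat_adjoint Hhat = Hhat \<and> mat_adjoint Hs = Hs \<and>
            hermitian_rmat (rat_of_pmat L) \<and> strongly_minimal_linearization rf L R) \<and>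
         (skew_hermitian_rmat R \<and> U = V \<longrightarrow>
            mat_adjoint Hhat = - Hhat \<and> mat_adjoint Hs = - Hs \<and>
            skew_hermitian_rmat (rat_of_pmat L) \<and> strongly_minimal_linearization rf L R) \<and>
         (para_hermitian_rmat R \<and> U = S * V \<longrightarrow>
            mat_adjoint Hhat = - Hhat \<and> mat_adjoint (S * Hs) = S * Hs \<and>
            para_hermitian_rmat (rat_of_pmat Lpara) \<and> strongly_minimal_linearization rf Lpara R) \<and>
         (para_skew_hermitian_rmat R \<and> U = S * V \<longrightarrow>
            mat_adjoint Hhat = Hhat \<and> mat_adjoint (S * Hs) = - (S * Hs) \<and>
            para_skew_hermitian_rmat (rat_of_pmat Lpara) \<and> strongly_minimal_linearization rf Lpara R)"
proof -
  have Hs: "Hs \<in> carrier_mat (k * m) (k * m)"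
    by (simp add: assms(4) hankel_shifted_def)
  note sizes = assms(1,2,6)
  have plain: "mat_adjoint Hhat = s \<cdot>\<^sub>m Hhat \<and> mat_adjoint Hs = s \<cdot>\<^sub>m Hs \<and>
      self_conjugate_rmat 1 s (rat_of_pmat L) \<and> strongly_minimal_linearization rf L R"
    if "self_conjugate_rmat 1 s R" "U = V" for s
  proof -
    have U: "U = sign_power_mat 1 m k * V"
      using assms(10) that(2) by (simp add: sign_power_mat_simps)
    have "sign_power_mat 1 m k * Hs = Hs"
      using Hs by (simp add: sign_power_mat_simps)
    then show ?thesis
      using self_conjugate_linearization[OF sizes that(1) _ _ assms(10,11) U assms(9,12,13)
          assms(14)[unfolded assms(3)]]
      by (simp add: assms(17) smult_one_mat flip: assms(4) assms(15) assms(16))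
  qed
  \<comment> \<open>With \<open>e = - 1\<close> the sign \<open>s * e\<close> of \<open>Hhat\<close>
    is opposite to the sign \<open>s\<close> of \<open>S * Hs\<close>.\<close>
  have para: "mat_adjoint Hhat = - s \<cdot>\<^sub>m Hhat \<and> mat_adjoint (S * Hs) = s \<cdot>\<^sub>m (S * Hs) \<and>
      self_conjugate_rmat (- 1) s (rat_of_pmat Lpara) \<and> strongly_minimal_linearization rf Lpara R"
    if "self_conjugate_rmat (- 1) s R" "U = S * V" for s
  proof -
    have U: "U = sign_power_mat (- 1) m k * V"
      using that(2) by (simp add: sign_power_mat_simps assms(7))
    show ?thesis
      using self_conjugate_linearization[OF sizes that(1) _ _ assms(10,11) U assms(9,12,13)
          assms(14)[unfolded assms(3)]]
      by (simp add: assms(18) smult_minus_one_mat sign_power_mat_simps flip: assms(4) assms(7) assms(15) assms(16))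
  qed
  show ?thesis
    using plain[of 1] plain[of "- 1"] para[of 1] para[of "- 1"]
    by (simp add: self_conjugate_rmat_iff smult_minus_one_mat smult_one_mat)
qed

end
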